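(* Let $m,n$ be natural numbers (positive integers) with $n\ge 2$. Let $\Phi:S_n\to S_m$ be a map preserving adjacency, with $\Phi(0)=0$. Then either: (i) there are a rank one matrix $B\in S_m$ and a function $f:S_n\to\mathbb{R}$ such that $\Phi(A)=f(A)B$ for all $A\in S_n$; or (ii) $m\ge n$ and there are $c\in\{-1,1\}$ and $R\in GL(m)$ such that for all $A\in S_n$ $$\Phi(A)=cR\begin{bmatrix}A&0\\0&0\end{bmatrix}R^T .$$
   Context: $S_n$ denotes the space of real symmetric $n\times n$ matrices; $GL(m)$ is the group of invertible real $m\times m$ matrices. Two matrices $A,B\in S_n$ are adjacent if $\operatorname{rank}(A-B)=1$. A map $\Phi:S_n\to S_m$ preserves adjacency if whenever $A,B\in S_n$ are adjacent, $\Phi(A)$ and $\Phi(B)$ are adjacent. No linearity, injectivity, surjectivity or continuity of $\Phi$ is assumed. In (ii) the block matrix is the $m\times m$ matrix with $A$ as its upper left $n\times n$ block and zeros elsewhere (it is just $A$ if $m=n$). *)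

theory Defs
  imports "Jordan_Normal_Form.DL_Rank"
begin

definition sym_mats :: "nat \<Rightarrow> real mat set" where
  "sym_mats n = {A \<in> carrier_mat n n. transpose_mat A = A}"

abbreviation mat_rank :: "nat \<Rightarrow> real mat \<Rightarrow> nat" where
  "mat_rank n \<equiv> vec_space.rank n"

definition adjacent :: "nat \<Rightarrow> real mat \<Rightarrow> real mat \<Rightarrow> bool" where
  "adjacent n A B \<longleftrightarrow> A \<in> sym_mats n \<and> B \<in> sym_mats n \<and> mat_rank n (A - B) = 1"

definition preserves_adjacency :: "nat \<Rightarrow> nat \<Rightarrow> (real mat \<Rightarrow> real mat) \<Rightarrow> bool" where
  "preserves_adjacency n m \<Phi> \<longleftrightarrow>
    (\<forall>A \<in> sym_mats n. \<forall>B \<in> sym_mats n. adjacent n A B \<longrightarrow> adjacent m (\<Phi> A) (\<Phi> B))"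

definition GL :: "nat \<Rightarrow> real mat set" where
  "GL m = {R \<in> carrier_mat m m. invertible_mat R}"

text \<open>Padding with zero blocks; for \<open>n \<le> m\<close> and \<open>A\<close> of size \<open>n \<times> n\<close> the result is of size
  \<open>m \<times> m\<close>. For \<open>n > m\<close> truncated subtraction makes it meaningless.\<close>

definition pad_zero :: "nat \<Rightarrow> nat \<Rightarrow> real mat \<Rightarrow> real mat" where
  "pad_zero n m A =
    four_block_mat A (0\<^sub>m n (m - n)) (0\<^sub>m (m - n) n) (0\<^sub>m (m - n) (m - n))"

end

theory Submission
  imports
    Defs
    "HOL-Computational_Algebra.Polynomial"
    "HOL-Analysis.Product_Vector"
    "HOL-Library.Function_Algebras"
begin

text \<open>A rank one symmetric matrix is \<open>t x x\<^sup>T\<close>, and three pairwise adjacent matrices lie on a line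
  \<open>{A + t x x\<^sup>T}\<close>; so \<open>\<Phi>\<close> maps lines into lines, injectively. Fix \<open>A\<close> and independent \<open>p, q\<close>. The
  symmetric matrices over \<open>span {p, q}\<close> form a three-dimensional space in which adjacency means
  that the quadratic form \<open>a c - b\<^sup>2\<close> of the difference vanishes. If the lines through \<open>A\<close> in the directions
  \<open>p, q\<close> have the same image direction, then the whole slice is mapped into one line, because most points
  of it are adjacent to points of both lines with different images. Otherwise this happens
  nowhere in the slice, and \<open>\<Phi>\<close> becomes a map of the three-dimensional space into itself that keeps
  distinct null directions distinct. On a null line it is given by a function \<open>f\<close> of the real parameter;
  perspectivities between null lines show that \<open>1 / f\<close> changes by affine maps under translations
  and positive dilations of the parameter, and since \<open>f\<close> is finite on all of the real line it must be
  linear. So \<open>\<Phi>\<close> is additive on such slices.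

  A single slice of the second kind forces all slices to be of that kind, because otherwise two
  non-proportional rank one matrices in slices of the second kind would have the same image. Then \<open>\<Phi>\<close> is linear, maps \<open>x x\<^sup>T\<close> to \<open>c (T x) (T x)\<^sup>T\<close> with a fixed sign \<open>c\<close>, and \<open>T\<close> can be
  chosen linear. If all slices are of the first kind, everything is mapped into one line.\<close>

section \<open>A functional equation\<close>

text \<open>Square roots make \<open>\<eta>\<close> positive, and
  \<open>x + y = x * (1 + y / x)\<close> makes it additive on positive reals. So it is increasing
  and fixes positive rationals, and density of the rationals leaves only the identity.\<close>

lemma mult_add_one_imp_id:
  fixes \<eta> :: "real \<Rightarrow> real"
  assumes mult: "\<And>a b. a > 0 \<Longrightarrow> b > 0 \<Longrightarrow> \<eta> (a * b) = \<eta> a * \<eta> b"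
    and one: "\<And>a. a > 0 \<Longrightarrow> \<eta> (1 + a) = 1 + \<eta> a"
    and nz: "\<And>a. a > 0 \<Longrightarrow> \<eta> a \<noteq> 0"
    and "a > 0"
  shows "\<eta> a = a"
proof -
  have pos: "\<eta> x > 0" if "x > 0" for x
  proof -
    have "\<eta> x = \<eta> (sqrt x) * \<eta> (sqrt x)"
      using mult[of "sqrt x" "sqrt x"] that by simp
    moreover have "\<eta> (sqrt x) \<noteq> 0" using nz that by simp
    ultimately show ?thesis by (auto simp: zero_less_mult_iff)
  qed
  have add: "\<eta> (x + y) = \<eta> x + \<eta> y" if "x > 0" "y > 0" for x y
  proof -
    have "x + y = x * (1 + y / x)" using that by (simp add: distrib_left)
    also have "\<eta> \<dots> = \<eta> x * (1 + \<eta> (y / x))"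
      using mult[of x "1 + y / x"] one[of "y / x"] that by (simp add: add_pos_pos)
    also have "\<dots> = \<eta> x + \<eta> y" using mult[of x "y / x"] that by (simp add: distrib_left)
    finally show ?thesis .
  qed
  have mono: "\<eta> x < \<eta> y" if "x > 0" "x < y" for x y
    using add[of x "y - x"] pos[of "y - x"] that by simp
  have e1: "\<eta> 1 = 1" using mult[of 1 1] nz[of 1] by simp
  have nat: "\<eta> (real (Suc n)) = real (Suc n)" for n
  proof (induction n)
    case (Suc n)
    have "\<eta> (real (Suc (Suc n))) = \<eta> (1 + real (Suc n))" by simp
    also have "\<dots> = 1 + \<eta> (real (Suc n))" by (rule one) simp
    finally show ?case using Suc by simp
  qed (simp add: e1)
  have rat: "\<eta> r = r" if rat_r: "r \<in> \<rat>" and r_pos: "r > 0" for r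
  proof -
    obtain p q where pq: "q > 0" "r = real_of_int p / real_of_int q"
      using rat_r by (elim Rats_cases') blast
    define m k where "m = nat p - 1" and "k = nat q - 1"
    have "p > 0" using pq r_pos by (simp add: zero_less_divide_iff)
    then have r: "r = real (Suc m) / real (Suc k)" using pq by (simp add: m_def k_def)
    have "\<eta> (real (Suc k) * r) = real (Suc k) * \<eta> r"
      using mult[of "real (Suc k)" r] r_pos nat[of k] by (simp del: of_nat_Suc)
    moreover have "real (Suc k) * r = real (Suc m)" using r by (simp del: of_nat_Suc)
    ultimately have "real (Suc k) * \<eta> r = real (Suc k) * r" using nat[of m] by metis
    then show ?thesis by (simp del: of_nat_Suc)
  qed
  show ?thesis
  proof (rule ccontr)
    assume "\<eta> a \<noteq> a"
    then consider "\<eta> a < a" | "a < \<eta> a" by linarith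
    then show False
    proof cases
      case 1
      then obtain r where "r \<in> \<rat>" "\<eta> a < r" "r < a" using Rats_dense_in_real by blast
      then show False using mono[of r a] rat[of r] pos[OF \<open>a > 0\<close>] by auto
    next
      case 2
      then obtain r where "r \<in> \<rat>" "r < \<eta> a" "a < r" using Rats_dense_in_real by blast
      then show False using mono[of a r] rat[of r] \<open>a > 0\<close> by auto
    qed
  qed
qed

text \<open>Turns a cubic identity with infinitely many solutions into equations for its
  coefficients; \<open>S\<close> will be the image of the positive reals under an injective
  function.\<close>

lemma cubic_vanishing:
  fixes c0 c1 c2 c3 :: real
  assumes "infinite S" "\<And>w. w \<in> S \<Longrightarrow> c0 + c1 * w + c2 * w^2 + c3 * w^3 = 0"
  shows "c0 = 0 \<and> c1 = 0 \<and> c2 = 0 \<and> c3 = 0"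
proof (rule ccontr)
  assume "\<not> ?thesis"
  then have "[:c0, c1, c2, c3:] \<noteq> 0" by auto
  then have "finite {w. poly [:c0, c1, c2, c3:] w = 0}" by (rule poly_roots_finite)
  moreover have "S \<subseteq> {w. poly [:c0, c1, c2, c3:] w = 0}"
    using assms(2) by (auto simp: algebra_simps power2_eq_square power3_eq_cube)
  ultimately show False using assms(1) finite_subset by blast
qed

text \<open>Meant for \<open>F = 1 / f\<close>. Dilations of the argument act on the values of
  \<open>F\<close> by commuting affine maps. If one of them is not a translation, they share a fixed
  point \<open>C\<close> and \<open>F - C\<close> is multiplicative up to a factor; otherwise
  \<open>F - F 1\<close> behaves like a logarithm, which \<open>shift\<close> excludes.\<close>

lemma affine_functional_equation:
  fixes F :: "real \<Rightarrow> real"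
  assumes inj: "\<And>a b. a > 0 \<Longrightarrow> b > 0 \<Longrightarrow> F a = F b \<Longrightarrow> a = b"
    and dil: "\<And>s. s > 0 \<Longrightarrow> \<exists>\<alpha> \<beta>. \<forall>a>0. F (s * a) = \<alpha> * F a + \<beta>"
    and shift: "\<exists>\<alpha> \<beta>. \<forall>a>0. (\<alpha> * F a + \<beta>) * (F 1 - F (1 + a)) = 1"
  shows "\<exists>C E. E \<noteq> 0 \<and> (\<forall>a>0. F a = C + E / a)"
proof -
  obtain \<alpha> \<beta> where sh: "\<And>a. a > 0 \<Longrightarrow> (\<alpha> * F a + \<beta>) * (F 1 - F (1 + a)) = 1"
    using shift by auto
  have "\<forall>s. \<exists>\<alpha> \<beta>. s > 0 \<longrightarrow> (\<forall>a>0. F (s * a) = \<alpha> * F a + \<beta>)"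
    using dil by blast
  then obtain D A where DA: "\<And>s a. s > 0 \<Longrightarrow> a > 0 \<Longrightarrow> F (s * a) = D s * F a + A s"
    by metis
  have F12: "F 1 \<noteq> F 2" using inj[of 1 2] by auto
  \<comment> \<open>Otherwise the first factor in \<open>sh\<close> is constant, and so is
    \<open>F (1 + a)\<close>.\<close>
  have \<alpha>0: "\<alpha> \<noteq> 0"
  proof
    assume "\<alpha> = 0"
    with sh[of 1] sh[of 2] have "\<beta> * (F 1 - F 2) = 1" "\<beta> * (F 1 - F 3) = 1" by auto
    then have "\<beta> * F 2 = \<beta> * F 3" and "\<beta> \<noteq> 0"
      unfolding right_diff_distrib by (linarith, auto)
    then have "F 2 = F 3" by simp
    then show False using inj[of 2 3] by auto
  qed
  show ?thesis
  proof (cases "\<exists>s>0. D s \<noteq> 1")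
    case True
    then obtain l where l: "l > 0" "D l \<noteq> 1" by blast
    \<comment> \<open>The fixed point of the affine map that belongs to the dilation by
      \<open>l\<close>.\<close>
    define C where "C = A l / (1 - D l)"
    have "C * (1 - D l) = A l" using l by (simp add: C_def)
    then have C: "A l = C - D l * C" by (simp add: algebra_simps)
    have hom: "F (s * a) - C = D s * (F a - C)" if "s > 0" "a > 0" for s a
    proof -
      \<comment> \<open>The amount by which the affine map of \<open>s\<close> moves
        \<open>C\<close>. Comparing \<open>F (s * l)\<close> with \<open>F (l * s)\<close> gives
        \<open>(1 - D l) * e = 0\<close>.\<close>
      define e where "e = D s * C + A s - C"
      have "F (s * (l * 1)) = D s * (D l * F 1 + A l) + A s"
        using DA[of s "l*1"] DA[of l 1] that l by simp
      moreover have "F (l * (s * 1)) = D l * (D s * F 1 + A s) + A l"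
        using DA[of l "s*1"] DA[of s 1] that l by simp
      ultimately have "D s * A l + A s = D l * A s + A l"
        by (simp add: algebra_simps)
      then have "(1 - D l) * e = 0" unfolding e_def C by (simp add: algebra_simps)
      then have "e = 0" using l by simp
      then show ?thesis using DA[OF that] unfolding e_def by (simp add: algebra_simps)
    qed
    define E where "E = F 1 - C"
    have FE: "F a = C + E * D a" if "a > 0" for a
      using hom[of a 1] that by (simp add: E_def algebra_simps)
    have E0: "E \<noteq> 0" using FE[of 1] FE[of 2] F12 by auto
    have "E * D 1 = F 1 - C" using FE[of 1] by simp
    then have "E * (D 1 - 1) = 0" by (simp add: E_def right_diff_distrib)
    then have D1: "D 1 = 1" using E0 by simp
    have Dmult: "D (a * b) = D a * D b" if "a > 0" "b > 0" for a b
      using hom[OF that] FE[of "a*b"] FE[of b] that E0 by simp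
    have D0: "D a \<noteq> 0" if "a > 0" for a
      using Dmult[of a "1/a"] that D1 by auto
    have Dinj: "a = b" if "a > 0" "b > 0" "D a = D b" for a b
      using inj[of a b] FE[of a] FE[of b] that by simp
    \<comment> \<open>The coefficients that \<open>sh\<close> acquires once \<open>F\<close> is
      replaced by \<open>C + E * D\<close>.\<close>
    define u v where "u = - (\<alpha> * E * E)" and "v = - ((\<alpha> * C + \<beta>) * E)"
    have eq1: "(u * D a + v) * (D (1 + a) - 1) = 1" if "a > 0" for a
      using sh[OF that] FE[of a] FE[of 1] FE[of "1 + a"] that D1
      unfolding u_def v_def by (simp add: algebra_simps)
    have u0: "u \<noteq> 0" unfolding u_def using \<alpha>0 E0 by simp
    \<comment> \<open>from \<open>eq1\<close> at \<open>a\<close> and at \<open>1 / a\<close>, by eliminating \<open>D (1 + a)\<close>\<close>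
    have cubic: "(u + u*v) + (u*u - u*v + v + v*v) * D a + (u*v - u*u - v - v*v) * (D a)^2
        + (- u - u*v) * (D a)^3 = 0" if a: "a > 0" for a
    proof -
      define w z where "w = D a" and "z = D (1 + a)"
      have "D (1 + 1 / a) = D ((1 / a) * (1 + a))" using a by (simp add: field_simps)
      also have "\<dots> = D (1 / a) * z" unfolding z_def using a by (subst Dmult) auto
      finally have "D (1 + 1 / a) * w = (D (1 / a) * w) * z" by simp
      moreover have 2: "D (1 / a) * w = 1" using Dmult[of a "1/a"] a D1 by (simp add: w_def mult.commute)
      ultimately have 1: "D (1 + 1 / a) * w = z" by simp
      have "w * w = w * w * ((u * D (1 / a) + v) * (D (1 + 1 / a) - 1))" using eq1[of "1/a"] a by simp
      also have "\<dots> = (u * (D (1/a) * w) + v * w) * (D (1 + 1 / a) * w - w)" by (simp add: algebra_simps)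
      finally have ii: "w * w = (u + v * w) * (z - w)" unfolding 1 2 by simp
      have i: "(u * w + v) * (z - 1) = 1" using eq1[OF a] by (simp add: w_def z_def)
      have "w * w * (u * w + v) = (u + v * w) * ((u * w + v) * (z - 1) + (u * w + v) * (1 - w))"
        unfolding ii by (simp add: algebra_simps)
      then show ?thesis unfolding i w_def[symmetric]
        by (simp add: algebra_simps power2_eq_square power3_eq_cube)
    qed
    have "inj_on D {0<..}" using Dinj by (auto intro: inj_onI)
    then have "infinite (D ` {0<..})" using infinite_Ioi finite_imageD by blast
    from cubic_vanishing[OF this, of "u + u*v" "u*u - u*v + v + v*v" "u*v - u*u - v - v*v" "- u - u*v"] cubic
    have "u + u * v = 0" "u*u - u*v + v + v*v = 0" by auto
    then have "u * (1 + v) = 0" by (simp add: algebra_simps)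
    then have v: "v = -1" using u0 by simp
    with \<open>u*u - u*v + v + v*v = 0\<close> have "u * (u + 1) = 0" by (simp add: algebra_simps)
    then have u: "u = -1" using u0 by simp
    \<comment> \<open>For \<open>u = v = -1\<close>, \<open>eq1\<close> reads
      \<open>(D a + 1) * (1 - D (1 + a)) = 1\<close>, which says that \<open>1 / D\<close> increases
      by one when its argument does.\<close>
    have inv: "1 / D a = a" if "a > 0" for a
    proof (rule mult_add_one_imp_id[of "\<lambda>a. 1 / D a"])
      fix a :: real assume "a > 0"
      have *: "(D a + 1) * (1 - D (1 + a)) = 1" using eq1[OF \<open>a > 0\<close>] unfolding u v by (simp add: algebra_simps)
      then have "D a + 1 \<noteq> 0" by auto
      then show "1 / D (1 + a) = 1 + 1 / D a"
        using * D0[OF \<open>a > 0\<close>] D0[of "1 + a"] \<open>a > 0\<close> by (simp add: field_simps)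
    qed (use Dmult D0 that in auto)
    have "F a = C + E / a" if "a > 0" for a
    proof -
      have "E / a = E / (1 / D a)" by (simp add: inv[OF that])
      then show ?thesis using FE[OF that] by simp
    qed
    then show ?thesis using E0 by blast
  next
    case False
    define L where "L a = F a - F 1" for a
    have L: "L (s * a) = L s + L a" if "s > 0" "a > 0" for s a
      using DA[OF that] DA[of s 1] False that by (auto simp: L_def)
    have L1: "L 1 = 0" by (simp add: L_def)
    define v where "v = \<alpha> * F 1 + \<beta>"
    have eq1: "(\<alpha> * L a + v) * (- L (1 + a)) = 1" if "a > 0" for a
      using sh[OF that] by (simp add: L_def v_def algebra_simps)
    \<comment> \<open>Again \<open>eq1\<close> at \<open>a\<close> and at \<open>1 / a\<close>, now
      with \<open>L (1 / a) = - L a\<close>. The cubic coefficient is minus the square of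
      \<open>\<alpha>\<close>, so \<open>\<alpha>\<close> would vanish.\<close>
    have cubic: "0 + (v * v - 2 * \<alpha>) * L a + 0 * (L a)^2 + (- (\<alpha> * \<alpha>)) * (L a)^3 = 0" if a: "a > 0" for a
    proof -
      define w z where "w = L a" and "z = L (1 + a)"
      have inv: "L (1 / a) = - w" using L[of a "1/a"] a L1 by (simp add: w_def)
      have "L (1 + 1 / a) = L ((1 / a) * (1 + a))" using a by (simp add: field_simps)
      also have "\<dots> = z - w" unfolding z_def using a inv by (subst L) auto
      finally have 1: "L (1 + 1 / a) = z - w" .
      have ii: "(v - \<alpha> * w) * (w - z) = 1" using eq1[of "1/a"] a inv 1 by (simp add: algebra_simps)
      have i: "(\<alpha> * w + v) * (- z) = 1" using eq1[OF a] by (simp add: w_def z_def)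
      have "(\<alpha> * w + v) = (v - \<alpha> * w) * ((\<alpha> * w + v) * w + (\<alpha> * w + v) * (- z))"
        using arg_cong[OF ii, of "\<lambda>x. (\<alpha> * w + v) * x"] by (simp add: algebra_simps)
      then show ?thesis unfolding i w_def[symmetric]
        by (simp add: algebra_simps power2_eq_square power3_eq_cube)
    qed
    have "inj_on L {0<..}" using inj by (auto simp: L_def intro: inj_onI)
    then have "infinite (L ` {0<..})" using infinite_Ioi finite_imageD by blast
    from cubic_vanishing[OF this, of 0 "v * v - 2 * \<alpha>" 0 "- (\<alpha> * \<alpha>)"] cubic
    have "\<alpha> = 0" by auto
    then show ?thesis using \<alpha>0 by simp
  qed
qed


text \<open>On positive arguments \<open>f\<close> is a Moebius function
  \<open>a / (E + C * a)\<close>. A shift carries the formula to negative arguments, and since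
  \<open>f\<close> takes a real value everywhere there is no pole, so \<open>C = 0\<close>.\<close>

lemma line_function_linear:
  fixes f :: "real \<Rightarrow> real"
  assumes inj: "inj f" and f0: "f 0 = 0"
    and dil: "\<And>s. s > 0 \<Longrightarrow> \<exists>\<alpha> \<beta>. \<forall>a>0. inverse (f (s * a)) = \<alpha> * inverse (f a) + \<beta>"
    and shift: "\<And>h. \<exists>\<alpha> \<beta>. \<forall>a. a \<noteq> 0 \<longrightarrow> inverse (f (h + a) - f h) = \<alpha> * inverse (f a) + \<beta>"
  shows "f a = a * f 1"
proof -
  define F where "F a = inverse (f a)" for a
  have fnz: "f a \<noteq> 0" if "a \<noteq> 0" for a
    using injD[OF inj, of a 0] f0 that by auto
  have fF: "f a = inverse (F a)" for a by (simp add: F_def)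
  have Fnz: "F a \<noteq> 0" if "a \<noteq> 0" for a using fnz[OF that] by (simp add: F_def)
  have "\<exists>C E. E \<noteq> 0 \<and> (\<forall>a>0. F a = C + E / a)"
  proof (rule affine_functional_equation)
    fix a b :: real assume "F a = F b"
    then show "a = b" using injD[OF inj, of a b] by (simp add: F_def)
  next
    obtain \<alpha> \<beta> where ab: "\<And>a. a \<noteq> 0 \<Longrightarrow> inverse (f (1 + a) - f 1) = \<alpha> * F a + \<beta>"
      using shift[of 1] by (auto simp: F_def)
    have "(\<alpha> * (f 1)^2 * F a + (\<beta> + F 1) * (f 1)^2) * (F 1 - F (1 + a)) = 1" if "a > 0" for a
    proof -
      \<comment> \<open>As \<open>F 1 - F (1 + a) = e / (f 1 * (f 1 + e))\<close>, its reciprocal is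
        \<open>(1 / e + 1 / f 1) * (f 1)^2\<close>, and the shift by 1 makes \<open>1 / e\<close>
        affine in \<open>F a\<close>.\<close>
      define e where "e = f (1 + a) - f 1"
      have e: "f (1 + a) = f 1 + e" by (simp add: e_def)
      have "e \<noteq> 0" using injD[OF inj, of "1+a" 1] that by (auto simp: e_def)
      have nz: "f 1 \<noteq> 0" "f 1 + e \<noteq> 0" using fnz[of 1] fnz[of "1 + a"] that by (auto simp: e_def)
      have "(\<alpha> * (f 1)^2 * F a + (\<beta> + F 1) * (f 1)^2) = (inverse e + F 1) * (f 1)^2"
        using ab[of a] that by (simp add: e_def algebra_simps)
      also have "\<dots> * (F 1 - F (1 + a)) = 1"
      proof -
        have "inverse e + F 1 = (f 1 + e) / (e * f 1)" "F 1 - F (1 + a) = e / (f 1 * (f 1 + e))"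
          unfolding F_def e using nz \<open>e \<noteq> 0\<close> by (simp_all add: field_simps)
        then show ?thesis using nz \<open>e \<noteq> 0\<close> by (simp add: power2_eq_square)
      qed
      finally show ?thesis .
    qed
    then show "\<exists>\<alpha> \<beta>. \<forall>a>0. (\<alpha> * F a + \<beta>) * (F 1 - F (1 + a)) = 1" by blast
  qed (use dil in \<open>simp add: F_def\<close>)
  then obtain C E where E: "E \<noteq> 0" and pos: "\<And>a. a > 0 \<Longrightarrow> F a = C + E / a" by blast
  have neg: "F (- b) = C - E / b" if b: "b > 0" for b
  proof -
    \<comment> \<open>Any \<open>h > b\<close> would do: both \<open>h\<close> and
      \<open>h - b\<close> are then positive, where \<open>F\<close> is known.\<close>
    define h where "h = b + 1"
    have h: "h > 0" using b by (simp add: h_def)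
    obtain \<alpha> \<beta> where ab: "\<And>a. a \<noteq> 0 \<Longrightarrow> inverse (f (h + a) - f h) = \<alpha> * F a + \<beta>"
      using shift[of h] by (auto simp: F_def)
    define K where "K = E + C * h"
    have Kh: "F h * h = K" using pos[OF h] h by (simp add: K_def field_simps)
    have K: "K \<noteq> 0" using Kh Fnz[of h] h by auto
    have G: "\<alpha> * F x + \<beta> = K^2 / (E * x) + C * K / E" if x: "x > - h" "x \<noteq> 0" for x
    proof -
      have "F (h + x) * (h + x) = K + C * x" using pos[of "h+x"] x by (simp add: K_def field_simps)
      moreover have "F (h + x) \<noteq> 0" "h + x \<noteq> 0" using Fnz[of "h + x"] x by simp_all
      ultimately have K': "K + C * x \<noteq> 0" "f (h + x) = (h + x) / (K + C * x)"
        by (metis mult_eq_0_iff)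
          (simp add: fF divide_inverse flip: \<open>F (h + x) * (h + x) = K + C * x\<close>, simp add: \<open>h + x \<noteq> 0\<close>)
      have "f h = h / K" using Kh K h Fnz[of h] by (simp add: fF field_simps)
      then have "f (h + x) - f h = ((h + x) * K - h * (K + C * x)) / ((K + C * x) * K)"
        using K' K by (simp add: diff_frac_eq)
      also have "(h + x) * K - h * (K + C * x) = E * x" by (simp add: K_def algebra_simps)
      finally have "inverse (f (h + x) - f h) = ((K + C * x) * K) / (E * x)" by simp
      also have "\<dots> = K^2 / (E * x) + C * K / E"
        using x E by (simp add: add_divide_distrib distrib_right power2_eq_square)
      finally show ?thesis using ab[OF x(2)] by simp
    qed
    \<comment> \<open>The positive arguments 1 and 2 determine the affine map of the shift;
      evaluating it at \<open>- b\<close> then gives \<open>F (- b)\<close>.\<close>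
    have "\<alpha> * E / 2 = K^2 / E / 2" using G[of 1] G[of 2] h pos[of 1] pos[of 2] by (simp add: algebra_simps)
    then have \<alpha>: "\<alpha> * E = K^2 / E" by simp
    then have \<alpha>0: "\<alpha> \<noteq> 0" using K E by auto
    have "\<alpha> * C + \<beta> = C * K / E" using G[of 1] h pos[of 1] \<alpha> by (simp add: algebra_simps)
    moreover have "\<alpha> * F (- b) + \<beta> = - (K^2 / E) / b + C * K / E"
      using G[of "- b"] b by (simp add: h_def)
    ultimately have "\<alpha> * F (- b) = \<alpha> * (C - E / b)" using \<alpha> by (simp add: algebra_simps)
    then show ?thesis using \<alpha>0 by simp
  qed
  have all: "F a = C + E / a" if "a \<noteq> 0" for a
    using pos[of a] neg[of "- a"] that by (cases "a > 0") auto
  \<comment> \<open>For nonzero \<open>C\<close> the formula gives \<open>F (- E / C) = 0\<close>,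
    but \<open>F\<close> is the inverse of a nonzero number there.\<close>
  have "C = 0"
  proof (rule ccontr)
    assume "C \<noteq> 0"
    then show False using all[of "- E / C"] Fnz[of "- E / C"] E by simp
  qed
  then show ?thesis using all[of a] all[of 1] f0 by (cases "a = 0") (auto simp: fF divide_inverse)
qed

section \<open>Maps of three-space respecting null directions\<close>

type_synonym r3 = "real \<times> real \<times> real"

text \<open>The triple \<open>(a, b, c)\<close> stands for the symmetric matrix with diagonal \<open>a, c\<close> and off-diagonal entry
  \<open>b\<close>; \<open>qf\<close> is its determinant.\<close>

definition qf :: "r3 \<Rightarrow> real" where
  "qf = (\<lambda>(a, b, c). a * c - b * b)"

text \<open>The polar form of \<open>qf\<close> without the factor one half, so
  \<open>qb x x = 2 * qf x\<close>.\<close>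

definition qb :: "r3 \<Rightarrow> r3 \<Rightarrow> real" where
  "qb = (\<lambda>(a, b, c) (a', b', c'). a * c' + a' * c - 2 * b * b')"

lemma qf_zero: "qf 0 = 0"
  by (simp add: qf_def zero_prod_def)

lemma qf_add: "qf (x + y) = qf x + qf y + qb x y"
  and qf_diff: "qf (x - y) = qf x + qf y - qb x y"
  and qf_scaleR: "qf (t *\<^sub>R x) = t * t * qf x"
  and qf_minus: "qf (- x) = qf x"
  by (cases x; cases y; simp add: qf_def qb_def algebra_simps)+

lemma qb_add_left: "qb (x + y) z = qb x z + qb y z"
  and qb_add_right: "qb z (x + y) = qb z x + qb z y"
  and qb_diff_left: "qb (x - y) z = qb x z - qb y z"
  and qb_diff_right: "qb z (x - y) = qb z x - qb z y"
  and qb_scaleR_left: "qb (t *\<^sub>R x) z = t * qb x z"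
  and qb_scaleR_right: "qb z (t *\<^sub>R x) = t * qb z x"
  and qb_minus_left: "qb (- x) z = - qb x z"
  and qb_minus_right: "qb z (- x) = - qb z x"
  by (cases x; cases y; cases z; simp add: qf_def qb_def algebra_simps)+

lemma qb_commute: "qb x y = qb y x"
  by (cases x; cases y; simp add: qb_def)

lemmas q_simps = qf_add qf_diff qf_scaleR qf_minus qb_add_left qb_add_right qb_diff_left qb_diff_right
  qb_scaleR_left qb_scaleR_right qb_minus_left qb_minus_right

text \<open>The form has signature (1,2), so its totally null subspaces have dimension at most one.
  In coordinates the square of \<open>a * b' - a' * b\<close> vanishes.\<close>

lemma null_parallel:
  assumes "qf u = 0" "qf v = 0" "qb u v = 0" "u \<noteq> 0"
  shows "\<exists>t. v = t *\<^sub>R u"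
proof -
  obtain a b c where u: "u = (a, b, c)" by (cases u)
  obtain a' b' c' where v: "v = (a', b', c')" by (cases v)
  have 1: "a * c = b * b" "a' * c' = b' * b'" "a * c' + a' * c = 2 * b * b'"
    using assms by (auto simp: qf_def qb_def u v)
  show ?thesis
  proof (cases "a = 0")
    case False
    have "(a * b' - a' * b)^2 = a * a * (b' * b') + a' * a' * (b * b) - a * a' * (2 * b * b')"
      by (simp add: power2_eq_square algebra_simps)
    also have "\<dots> = 0" unfolding 1[symmetric] by (simp add: algebra_simps)
    finally have b': "b' = a' / a * b" using False by (simp add: field_simps)
    have "a * c' = 2 * b * b' - a' * c" using 1 by simp
    then have "a * a * c' = 2 * a' * (b * b) - a' * (a * c)" using b' False by (simp add: field_simps)
    then have "c' = a' / a * c" unfolding 1(1)[symmetric] using False by (simp add: field_simps)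
    then have "v = (a' / a) *\<^sub>R u" using b' False by (simp add: u v)
    then show ?thesis ..
  next
    case True
    then have "b = 0" "c \<noteq> 0" using 1 assms(4) by (auto simp: u zero_prod_def)
    moreover from this have "a' = 0" "b' = 0" using 1 True by auto
    ultimately have "v = (c' / c) *\<^sub>R u" using True by (simp add: u v)
    then show ?thesis ..
  qed
qed

text \<open>The null condition between \<open>w + s *\<^sub>R v\<close> and
  \<open>f *\<^sub>R u\<close> has only terms in \<open>s\<close>, \<open>f\<close> and
  \<open>s * f\<close>. Division by \<open>s * f\<close> makes it affine in the reciprocals, which
  is why inverses of coordinates occur from here on.\<close>

lemma null_triangle:
  assumes "qf u = 0" "qf v = 0" "qf w = 0" "qf (w + s *\<^sub>R v - f *\<^sub>R u) = 0"
    and "s \<noteq> 0" "f \<noteq> 0" "qb w u \<noteq> 0"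
  shows "inverse s = qb w v / qb w u * inverse f - qb v u / qb w u"
proof -
  have "s * qb w v - f * qb w u - s * f * qb v u = 0"
    using assms(4) by (simp add: q_simps assms(1-3) algebra_simps)
  then show ?thesis using assms(5-7) by (simp add: field_simps)
qed

text \<open>A slice of the second kind in coordinates. For nonzero null vectors, vanishing of
  \<open>qb\<close> means being parallel, so \<open>nondeg\<close> keeps image directions distinct
  at every base point.\<close>

locale nondeg_null_map =
  fixes \<Psi> :: "r3 \<Rightarrow> r3"
  assumes adj: "\<And>x y. qf (x - y) = 0 \<Longrightarrow> x \<noteq> y \<Longrightarrow> qf (\<Psi> x - \<Psi> y) = 0 \<and> \<Psi> x \<noteq> \<Psi> y"
    and nondeg: "\<And>z u v. qf u = 0 \<Longrightarrow> qf v = 0 \<Longrightarrow> qb u v \<noteq> 0 \<Longrightarrow>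
      qb (\<Psi> (z + u) - \<Psi> z) (\<Psi> (z + v) - \<Psi> z) \<noteq> 0"
begin

section \<open>Coordinates on null lines and their images\<close>

definition d :: "r3 \<Rightarrow> r3 \<Rightarrow> r3" where
  "d z u = \<Psi> (z + u) - \<Psi> z"

lemma d_null: "qf u = 0 \<Longrightarrow> qf (d z u) = 0"
  using adj[of "z + u" z] by (cases "u = 0") (auto simp: d_def qf_zero)

lemma d_nz: "qf u = 0 \<Longrightarrow> u \<noteq> 0 \<Longrightarrow> d z u \<noteq> 0"
  using adj[of "z + u" z] by (auto simp: d_def)

text \<open>The images of \<open>z\<close>, \<open>z + u\<close> and
  \<open>z + t *\<^sub>R u\<close> differ pairwise by null vectors, so the two differences from
  \<open>\<Psi> z\<close> are orthogonal and \<open>null_parallel\<close> applies.\<close>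

lemma line_image:
  assumes "qf u = 0" "u \<noteq> 0"
  shows "\<exists>f. \<Psi> (z + t *\<^sub>R u) = \<Psi> z + f *\<^sub>R d z u"
proof -
  define P where "P = \<Psi> (z + t *\<^sub>R u) - \<Psi> z"
  have "qf P = 0" using d_null[of "t *\<^sub>R u" z] assms by (simp add: P_def d_def qf_scaleR)
  moreover have "qf (P - d z u) = 0"
  proof (cases "t = 1")
    case False
    have e: "z + t *\<^sub>R u - (z + u) = (t - 1) *\<^sub>R u" by (simp add: algebra_simps)
    have "z + t *\<^sub>R u \<noteq> z + u" using e False assms by auto
    moreover have "qf (z + t *\<^sub>R u - (z + u)) = 0" unfolding e by (simp add: qf_scaleR assms)
    ultimately show ?thesis using adj[of "z + t *\<^sub>R u" "z + u"] by (simp add: P_def d_def)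
  qed (simp add: P_def d_def qf_zero)
  ultimately have "qb (d z u) P = 0" using d_null[OF assms(1), of z] by (simp add: q_simps qb_commute)
  then obtain f where "P = f *\<^sub>R d z u"
    using null_parallel[of "d z u" P] \<open>qf P = 0\<close> d_null[of u z] d_nz[of u z] assms by blast
  then show ?thesis by (auto simp: P_def algebra_simps)
qed

text \<open>For nonzero null \<open>u\<close> the number exists by \<open>line_image\<close>. The
  unit \<open>d z u\<close> gives the parameter 1 the coordinate 1.\<close>

definition coord :: "r3 \<Rightarrow> r3 \<Rightarrow> real \<Rightarrow> real" where
  "coord z u t = (SOME f. \<Psi> (z + t *\<^sub>R u) = \<Psi> z + f *\<^sub>R d z u)"

context
  fixes u :: r3
  assumes u: "qf u = 0" "u \<noteq> 0"
begin

lemma coord: "\<Psi> (z + t *\<^sub>R u) = \<Psi> z + coord z u t *\<^sub>R d z u"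
  unfolding coord_def by (rule someI_ex[OF line_image[OF u]])

lemma coord_inj: "inj (coord z u)"
proof (rule injI, rule ccontr)
  fix s t assume "coord z u s = coord z u t" "s \<noteq> t"
  then have "\<Psi> (z + s *\<^sub>R u) = \<Psi> (z + t *\<^sub>R u)" by (simp add: coord)
  moreover have e: "(z + s *\<^sub>R u) - (z + t *\<^sub>R u) = (s - t) *\<^sub>R u" by (simp add: algebra_simps)
  then have "z + s *\<^sub>R u \<noteq> z + t *\<^sub>R u" using u \<open>s \<noteq> t\<close> by auto
  ultimately show False using adj[of "z + s *\<^sub>R u" "z + t *\<^sub>R u"] unfolding e by (simp add: qf_scaleR u)
qed

lemma coord_0: "coord z u 0 = 0" and coord_1: "coord z u 1 = 1"
proof -
  show "coord z u 0 = 0" using coord[of z 0] d_nz[OF u] by simp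
  have "\<Psi> (z + u) = \<Psi> z + coord z u 1 *\<^sub>R d z u" using coord[of z 1] by simp
  then have "d z u = coord z u 1 *\<^sub>R d z u" unfolding d_def by (metis add_diff_cancel_left')
  then have "(coord z u 1 - 1) *\<^sub>R d z u = 0" by (simp add: scaleR_left_diff_distrib)
  then show "coord z u 1 = 1" using d_nz[OF u, of z] by simp
qed

lemma coord_nz: "t \<noteq> 0 \<Longrightarrow> coord z u t \<noteq> 0"
  using injD[OF coord_inj, of z t 0] by (auto simp: coord_0)

text \<open>Translation by the null vector \<open>v\<close> joins each point of one line to its
  companion on a parallel line. \<open>null_triangle\<close> expresses this perspectivity on the
  image side.\<close>

lemma coord_shift_null:
  assumes v: "qf v = 0" "qb v u \<noteq> 0"
  shows "\<exists>\<alpha> \<beta>. \<forall>a. a \<noteq> 0 \<longrightarrow> inverse (coord (z + v) u a) = \<alpha> * inverse (coord z u a) + \<beta>"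
proof -
  define w' v' u' where "w' = d z v" and "v' = d (z + v) u" and "u' = d z u"
  have "inverse (coord (z + v) u a) = (qb w' v' / qb w' u') * inverse (coord z u a) + (- qb v' u' / qb w' u')"
    if "a \<noteq> 0" for a
  proof -
    have "v \<noteq> 0" using v by (auto simp: qb_def zero_prod_def)
    have "qf (\<Psi> (z + v + a *\<^sub>R u) - \<Psi> (z + a *\<^sub>R u)) = 0"
      using adj[of "z + v + a *\<^sub>R u" "z + a *\<^sub>R u"] v \<open>v \<noteq> 0\<close> by simp
    moreover have "\<Psi> (z + v + a *\<^sub>R u) - \<Psi> (z + a *\<^sub>R u) = w' + coord (z + v) u a *\<^sub>R v' - coord z u a *\<^sub>R u'"
      by (simp add: coord w'_def v'_def u'_def) (simp add: d_def)
    ultimately have "qf (w' + coord (z + v) u a *\<^sub>R v' - coord z u a *\<^sub>R u') = 0" by simp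
    from null_triangle[OF _ _ _ this] show ?thesis
      using d_null u v coord_nz[OF that] nondeg[of v u z] by (simp add: w'_def v'_def u'_def d_def)
  qed
  then show ?thesis by blast
qed

end

definition e1 :: r3 where "e1 = (1, 0, 0)"
definition e2 :: r3 where "e2 = (0, 0, 1)"

lemma e1: "qf e1 = 0" "e1 \<noteq> 0" and e2: "qf e2 = 0" "e2 \<noteq> 0" and e12: "qb e1 e2 = 1"
  by (auto simp: qf_def qb_def e1_def e2_def zero_prod_def)

lemma coord_shift_e1:
  "\<exists>\<alpha> \<beta>. \<forall>a. a \<noteq> 0 \<longrightarrow> inverse (coord (z + h *\<^sub>R e1) e1 a) = \<alpha> * inverse (coord z e1 a) + \<beta>"
proof (cases "h = 0")
  case True
  then show ?thesis by (intro exI[of _ 1] exI[of _ 0]) simp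
next
  case False
  \<comment> \<open>A shift along \<open>e1\<close> itself is not covered by
    \<open>coord_shift_null\<close>, as \<open>e1\<close> is orthogonal to itself. It is split into
    three null vectors, none of them orthogonal to \<open>e1\<close>.\<close>
  define v1 v2 v3 :: r3 where "v1 = (h / 2, h / 2, h / 2)" and "v2 = (h / 2, - h / 2, h / 2)"
    and "v3 = (0, 0, - h)"
  have v: "qf v1 = 0" "qb v1 e1 \<noteq> 0" "qf v2 = 0" "qb v2 e1 \<noteq> 0" "qf v3 = 0" "qb v3 e1 \<noteq> 0"
    using False by (auto simp: qf_def qb_def e1_def v1_def v2_def v3_def)
  have sum: "z + v1 + v2 + v3 = z + h *\<^sub>R e1"
    by (cases z) (simp add: e1_def v1_def v2_def v3_def)
  obtain \<alpha>1 \<beta>1 where 1: "\<And>a. a \<noteq> 0 \<Longrightarrow> inverse (coord (z + v1) e1 a) = \<alpha>1 * inverse (coord z e1 a) + \<beta>1"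
    using coord_shift_null[OF e1 v(1,2), of z] by auto
  obtain \<alpha>2 \<beta>2 where 2: "\<And>a. a \<noteq> 0 \<Longrightarrow> inverse (coord (z + v1 + v2) e1 a) = \<alpha>2 * inverse (coord (z + v1) e1 a) + \<beta>2"
    using coord_shift_null[OF e1 v(3,4), of "z + v1"] by auto
  obtain \<alpha>3 \<beta>3 where 3: "\<And>a. a \<noteq> 0 \<Longrightarrow> inverse (coord (z + v1 + v2 + v3) e1 a) = \<alpha>3 * inverse (coord (z + v1 + v2) e1 a) + \<beta>3"
    using coord_shift_null[OF e1 v(5,6), of "z + v1 + v2"] by auto
  have "inverse (coord (z + h *\<^sub>R e1) e1 a) = (\<alpha>3 * \<alpha>2 * \<alpha>1) * inverse (coord z e1 a) + (\<alpha>3 * (\<alpha>2 * \<beta>1 + \<beta>2) + \<beta>3)"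
    if "a \<noteq> 0" for a
    unfolding sum[symmetric] 3[OF that] 2[OF that] 1[OF that] by (simp add: algebra_simps)
  then show ?thesis by blast
qed

text \<open>A third null line matches the points of the two lines through \<open>z\<close>, with
  parameter ratio \<open>k^2\<close>. Comparing a general \<open>k\<close> with \<open>k = 1\<close>
  will produce every positive dilation of the \<open>e1\<close> line.\<close>

lemma coord_cross:
  assumes "k \<noteq> 0"
  shows "\<exists>\<alpha> \<beta>. \<alpha> \<noteq> 0 \<and> (\<forall>a>0. inverse (coord z e2 (k^2 * a)) = \<alpha> * inverse (coord z e1 a) + \<beta>)"
proof -
  \<comment> \<open>The auxiliary null line starts at \<open>z + w\<close> and has direction
    \<open>v\<close>.\<close>
  define w v :: r3 where "w = (- 1, k, - (k^2))" and "v = (1, k, k^2)"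
  have wv: "qf w = 0" "qf v = 0" "qb w v \<noteq> 0" "qb w e1 \<noteq> 0" "qb w e2 \<noteq> 0" "w \<noteq> 0" "v \<noteq> 0"
    using assms by (auto simp: qf_def qb_def e1_def e2_def w_def v_def zero_prod_def power2_eq_square)
  define w' v' u1 u2 where "w' = d z w" and "v' = d (z + w) v" and "u1 = d z e1" and "u2 = d z e2"
  have null: "qf w' = 0" "qf v' = 0" "qf u1 = 0" "qf u2 = 0"
    using d_null wv e1 e2 by (auto simp: w'_def v'_def u1_def u2_def)
  have nz: "qb w' u1 \<noteq> 0" "qb w' u2 \<noteq> 0"
    using nondeg[of w e1 z] nondeg[of w e2 z] wv e1 e2 by (auto simp: w'_def u1_def u2_def d_def)
  have w'v': "qb w' v' \<noteq> 0"
  proof -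
    have "qb (\<Psi> (z + w + - w) - \<Psi> (z + w)) (\<Psi> (z + w + v) - \<Psi> (z + w)) \<noteq> 0"
      by (rule nondeg) (use wv in \<open>auto simp: qf_minus qb_minus_left\<close>)
    moreover have "\<Psi> (z + w + - w) - \<Psi> (z + w) = - w'" by (simp add: w'_def d_def)
    ultimately show ?thesis by (simp add: v'_def d_def qb_minus_left)
  qed
  have "inverse (coord z e2 (k^2 * a)) = (qb w' u2 / qb w' u1) * inverse (coord z e1 a)
      + (qb v' u2 - qb v' u1 * qb w' u2 / qb w' u1) / qb w' v'" if a: "a > 0" for a
  proof -
    \<comment> \<open>chosen so that \<open>w + s *\<^sub>R v\<close> lies on the null cones of
      both \<open>a *\<^sub>R e1\<close> and \<open>(k^2 * a) *\<^sub>R e2\<close>\<close>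
    define s where "s = a / (4 + a)"
    have s: "s \<noteq> 0" "s * (4 + a) = a" using a by (auto simp: s_def)
    define t where "t = coord (z + w) v s"
    have t: "t \<noteq> 0" unfolding t_def by (rule coord_nz) (use wv s in auto)
    define X where "X = z + w + s *\<^sub>R v"
    have X: "\<Psi> X - \<Psi> z = w' + t *\<^sub>R v'"
      unfolding X_def by (subst coord) (use wv in \<open>auto simp: t_def w'_def v'_def d_def\<close>)
    have adj1: "qf (\<Psi> X - \<Psi> (z + u)) = 0" if "qf (w + s *\<^sub>R v - u) = 0" for u
    proof (cases "X = z + u")
      case True
      then show ?thesis by (simp add: qf_zero)
    next
      case False
      have e: "X - (z + u) = w + s *\<^sub>R v - u" by (simp add: X_def)
      show ?thesis using adj[of X "z + u"] False that unfolding e by simp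
    qed
    have "qf (w + s *\<^sub>R v - a *\<^sub>R e1) = k^2 * (a - s * (4 + a))"
      by (simp add: qf_def w_def v_def e1_def power2_eq_square algebra_simps)
    then have "qf (\<Psi> X - \<Psi> (z + a *\<^sub>R e1)) = 0" using adj1 s by simp
    moreover have "\<Psi> X - \<Psi> (z + a *\<^sub>R e1) = w' + t *\<^sub>R v' - coord z e1 a *\<^sub>R u1"
      using X by (simp add: coord[OF e1] u1_def algebra_simps)
    ultimately have 1: "inverse t = qb w' v' / qb w' u1 * inverse (coord z e1 a) - qb v' u1 / qb w' u1"
      using null_triangle[of u1 v' w' t "coord z e1 a"] null nz t coord_nz[OF e1, of a z] a by simp
    have "qf (w + s *\<^sub>R v - (k^2 * a) *\<^sub>R e2) = k^2 * (a - s * (4 + a))"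
      by (simp add: qf_def w_def v_def e2_def power2_eq_square algebra_simps)
    then have "qf (\<Psi> X - \<Psi> (z + (k^2 * a) *\<^sub>R e2)) = 0" using adj1 s by simp
    moreover have "\<Psi> X - \<Psi> (z + (k^2 * a) *\<^sub>R e2) = w' + t *\<^sub>R v' - coord z e2 (k^2 * a) *\<^sub>R u2"
      using X by (simp add: coord[OF e2] u2_def algebra_simps)
    ultimately have 2: "inverse t = qb w' v' / qb w' u2 * inverse (coord z e2 (k^2 * a)) - qb v' u2 / qb w' u2"
      using null_triangle[of u2 v' w' t "coord z e2 (k^2 * a)"] null nz t coord_nz[OF e2, of "k^2 * a" z] a assms by simp
    \<comment> \<open>Eliminates the coordinate \<open>t\<close> on the auxiliary line between the
      two incidence relations.\<close>
    have "qb w' v' * inverse (coord z e2 (k^2 * a)) = inverse t * qb w' u2 + qb v' u2"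
      unfolding 2 using nz by (simp add: field_simps)
    also have "\<dots> = qb w' v' * ((qb w' u2 / qb w' u1) * inverse (coord z e1 a)
      + (qb v' u2 - qb v' u1 * qb w' u2 / qb w' u1) / qb w' v')"
      unfolding 1 using nz w'v' by (simp add: distrib_left diff_divide_distrib left_diff_distrib right_diff_distrib)
    finally show ?thesis using w'v' by simp
  qed
  then show ?thesis
    using nz by (intro exI[of _ "qb w' u2 / qb w' u1"]
        exI[of _ "(qb v' u2 - qb v' u1 * qb w' u2 / qb w' u1) / qb w' v'"]) auto
qed

lemma coord_linear: "coord z e1 a = a"
proof -
  have "coord z e1 a = a * coord z e1 1"
  proof (rule line_function_linear[OF coord_inj[OF e1] coord_0[OF e1]])
    fix h
    obtain \<alpha> \<beta> where ab: "\<And>a. a \<noteq> 0 \<Longrightarrow> inverse (coord (z + h *\<^sub>R e1) e1 a) = \<alpha> * inverse (coord z e1 a) + \<beta>"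
      using coord_shift_e1 by blast
    \<comment> \<open>The line based at the shifted point has its own unit; this is the factor
      relating it to the unit at \<open>z\<close>.\<close>
    have D: "d (z + h *\<^sub>R e1) e1 = (coord z e1 (h + 1) - coord z e1 h) *\<^sub>R d z e1"
      using coord[OF e1, of z "h + 1"] coord[OF e1, of z h] by (simp add: d_def[of "z + h *\<^sub>R e1"] scaleR_left_diff_distrib scaleR_add_left add.assoc)
    have "inverse (coord z e1 (h + a) - coord z e1 h) =
      (\<alpha> / (coord z e1 (h + 1) - coord z e1 h)) * inverse (coord z e1 a) + \<beta> / (coord z e1 (h + 1) - coord z e1 h)"
      if "a \<noteq> 0" for a
    proof -
      have "\<Psi> (z + (h + a) *\<^sub>R e1) = \<Psi> (z + h *\<^sub>R e1 + a *\<^sub>R e1)" by (simp add: scaleR_add_left add.assoc)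
      then have "coord z e1 (h + a) *\<^sub>R d z e1 = coord z e1 h *\<^sub>R d z e1
          + coord (z + h *\<^sub>R e1) e1 a *\<^sub>R (coord z e1 (h + 1) - coord z e1 h) *\<^sub>R d z e1"
        unfolding coord[OF e1] D by simp
      then have "coord z e1 (h + a) *\<^sub>R d z e1 - coord z e1 h *\<^sub>R d z e1
          = (coord (z + h *\<^sub>R e1) e1 a * (coord z e1 (h + 1) - coord z e1 h)) *\<^sub>R d z e1"
        by (simp only: add_diff_cancel_left' scaleR_scaleR)
      then have "(coord z e1 (h + a) - coord z e1 h) *\<^sub>R d z e1
          = (coord (z + h *\<^sub>R e1) e1 a * (coord z e1 (h + 1) - coord z e1 h)) *\<^sub>R d z e1"
        by (simp only: scaleR_left_diff_distrib[of "coord z e1 (h + a)" "coord z e1 h"])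
      then have "coord z e1 (h + a) - coord z e1 h = coord (z + h *\<^sub>R e1) e1 a * (coord z e1 (h + 1) - coord z e1 h)"
        using d_nz[OF e1] by (metis scaleR_cancel_right)
      then have "inverse (coord z e1 (h + a) - coord z e1 h)
          = inverse (coord (z + h *\<^sub>R e1) e1 a) * inverse (coord z e1 (h + 1) - coord z e1 h)"
        by (simp only: inverse_mult_distrib)
      then show ?thesis unfolding ab[OF that] by (simp add: divide_inverse algebra_simps)
    qed
    then show "\<exists>\<alpha> \<beta>. \<forall>a. a \<noteq> 0 \<longrightarrow> inverse (coord z e1 (h + a) - coord z e1 h) = \<alpha> * inverse (coord z e1 a) + \<beta>"
      by blast
  next
    fix s :: real assume "s > 0"
    define k where "k = sqrt s"
    have k: "k \<noteq> 0" "k^2 = s" using \<open>s > 0\<close> by (auto simp: k_def)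
    obtain \<alpha> \<beta> where ab: "\<And>a. a > 0 \<Longrightarrow> inverse (coord z e2 (s * a)) = \<alpha> * inverse (coord z e1 a) + \<beta>"
      using coord_cross[OF k(1), of z] k(2) by auto
    \<comment> \<open>The case \<open>k = 1\<close> leads back from the \<open>e2\<close> line to
      the \<open>e1\<close> line; this needs a nonzero slope.\<close>
    obtain \<alpha>' \<beta>' where ab': "\<alpha>' \<noteq> 0" "\<And>a. a > 0 \<Longrightarrow> inverse (coord z e2 a) = \<alpha>' * inverse (coord z e1 a) + \<beta>'"
      using coord_cross[of 1 z] by auto
    have "inverse (coord z e1 (s * a)) = (\<alpha> / \<alpha>') * inverse (coord z e1 a) + (\<beta> - \<beta>') / \<alpha>'" if "a > 0" for a
    proof -
      have "\<alpha>' * inverse (coord z e1 (s * a)) + \<beta>' = \<alpha> * inverse (coord z e1 a) + \<beta>"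
        using ab[OF that] ab'(2)[of "s * a"] that \<open>s > 0\<close> by simp
      then have "inverse (coord z e1 (s * a)) = (\<alpha> * inverse (coord z e1 a) + (\<beta> - \<beta>')) / \<alpha>'"
        using ab'(1) by (simp add: eq_divide_eq algebra_simps)
      then show ?thesis by (simp add: add_divide_distrib)
    qed
    then show "\<exists>\<alpha> \<beta>. \<forall>a>0. inverse (coord z e1 (s * a)) = \<alpha> * inverse (coord z e1 a) + \<beta>" by blast
  qed
  then show ?thesis by (simp add: coord_1[OF e1])
qed

text \<open>With linear coordinates, \<open>w + a *\<^sub>R v - a *\<^sub>R u\<close> is null for
  every nonzero \<open>a\<close>. Two values of \<open>a\<close> give \<open>qb v u = 0\<close>, so
  \<open>v\<close> is a multiple of \<open>u\<close>, and \<open>qb w v = qb w u\<close> makes the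
  factor 1.\<close>

theorem parallelogram:
  "\<Psi> (z + a *\<^sub>R e1 + c *\<^sub>R e2) = \<Psi> (z + c *\<^sub>R e2) + a *\<^sub>R (\<Psi> (z + e1) - \<Psi> z)"
proof -
  define w v u where "w = d z (c *\<^sub>R e2)" and "v = d (z + c *\<^sub>R e2) e1" and "u = d z e1"
  have line: "\<Psi> (z + c *\<^sub>R e2 + a *\<^sub>R e1) = \<Psi> (z + c *\<^sub>R e2) + a *\<^sub>R v" for a
    using coord[OF e1] by (simp add: v_def coord_linear)
  have "v = u"
  proof (cases "c = 0")
    case False
    have null: "qf u = 0" "qf v = 0" "qf w = 0" "u \<noteq> 0"
      using d_null e1 e2 d_nz by (auto simp: u_def v_def w_def qf_scaleR)
    have wu: "qb w u \<noteq> 0"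
      using nondeg[of "c *\<^sub>R e2" e1 z] e1 e2 e12 False by (auto simp: w_def u_def d_def qf_scaleR q_simps qb_commute)
    have eq: "qb w v - qb w u - a * qb v u = 0" if "a \<noteq> 0" for a
    proof -
      have "qf (\<Psi> (z + c *\<^sub>R e2 + a *\<^sub>R e1) - \<Psi> (z + a *\<^sub>R e1)) = 0"
        using adj[of "z + c *\<^sub>R e2 + a *\<^sub>R e1" "z + a *\<^sub>R e1"] False e2 by (simp add: qf_scaleR)
      moreover have "\<Psi> (z + c *\<^sub>R e2 + a *\<^sub>R e1) - \<Psi> (z + a *\<^sub>R e1) = w + a *\<^sub>R v - a *\<^sub>R u"
        using coord[OF e1, of z a] by (simp add: line coord_linear w_def u_def) (simp add: d_def)
      ultimately have "qf (w + a *\<^sub>R v - a *\<^sub>R u) = 0" by simp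
      then have "a * (qb w v - qb w u - a * qb v u) = 0"
        by (simp add: q_simps null algebra_simps)
      then show ?thesis using that by simp
    qed
    have vu: "qb v u = 0" "qb w v = qb w u" using eq[of 1] eq[of 2] by auto
    obtain t where t: "v = t *\<^sub>R u" using null_parallel[of u v] null vu by (auto simp: qb_commute)
    then have "t = 1" using vu(2) wu by (simp add: q_simps)
    then show ?thesis using t by simp
  qed (simp add: v_def u_def)
  then show ?thesis using line[of a] by (simp add: u_def d_def add.commute add.left_commute add.assoc)
qed

end

section \<open>Rank one matrices\<close>

text \<open>Matrices are treated as functions of two indices, so that all sizes live in one real vector space.\<close>

instantiation "fun" :: (type, real_vector) real_vector
begin

definition scaleR_fun :: "real \<Rightarrow> ('a \<Rightarrow> 'b) \<Rightarrow> 'a \<Rightarrow> 'b" where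
  "scaleR_fun r f = (\<lambda>x. r *\<^sub>R f x)"

instance
  by standard (auto simp: scaleR_fun_def fun_eq_iff scaleR_add_left scaleR_add_right)

end

lemma scaleR_fun_apply [simp]: "(r *\<^sub>R f) x = r *\<^sub>R f x"
  by (simp add: scaleR_fun_def)

definition sq :: "('i \<Rightarrow> real) \<Rightarrow> 'i \<Rightarrow> 'i \<Rightarrow> real" where
  "sq x = (\<lambda>i j. x i * x j)"

text \<open>The polar form of \<open>sq\<close> without the factor one half.\<close>

definition sprod :: "('i \<Rightarrow> real) \<Rightarrow> ('i \<Rightarrow> real) \<Rightarrow> 'i \<Rightarrow> 'i \<Rightarrow> real" where
  "sprod x y = (\<lambda>i j. x i * y j + y i * x j)"

text \<open>Linear independence as a nonvanishing two by two minor, which is meaningful for every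
  index type.\<close>

definition nonpar :: "('i \<Rightarrow> real) \<Rightarrow> ('i \<Rightarrow> real) \<Rightarrow> bool" where
  "nonpar x y \<longleftrightarrow> (\<exists>i j. x i * y j \<noteq> x j * y i)"

text \<open>The factor \<open>t\<close> carries the sign and also admits the zero matrix.\<close>

definition rank_le1 :: "('i \<Rightarrow> 'i \<Rightarrow> real) \<Rightarrow> bool" where
  "rank_le1 M \<longleftrightarrow> (\<exists>t x. M = t *\<^sub>R sq x)"

lemma sq_add: "sq (x + y) = sq x + sprod x y + sq y"
  and sq_scaleR: "sq (c *\<^sub>R x) = (c * c) *\<^sub>R sq x"
  and sprod_add_left: "sprod (x + y) z = sprod x z + sprod y z"
  and sprod_scaleR_left: "sprod (c *\<^sub>R x) z = c *\<^sub>R sprod x z"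
  and sprod_self: "sprod x x = 2 *\<^sub>R sq x"
  and sprod_commute: "sprod x z = sprod z x"
  and sq_zero: "sq 0 = 0"
  by (simp_all add: sq_def sprod_def fun_eq_iff algebra_simps)

lemma sq_eq_0: "sq x = 0 \<longleftrightarrow> x = 0"
  by (auto simp: sq_def fun_eq_iff)

lemma nonpar_commute: "nonpar x y \<longleftrightarrow> nonpar y x"
  unfolding nonpar_def by (metis mult.commute)

lemma nonpar_nz: "nonpar x y \<Longrightarrow> x \<noteq> 0" "nonpar x y \<Longrightarrow> y \<noteq> 0"
  by (auto simp: nonpar_def)

lemma not_nonpar:
  assumes "\<not> nonpar x y" "x \<noteq> 0"
  obtains c where "y = c *\<^sub>R x"
proof -
  obtain i where i: "x i \<noteq> 0" using assms(2) by (auto simp: fun_eq_iff)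
  define c where "c = y i / x i"
  have "y j = c * x j" for j
  proof -
    have "x i * y j = x j * y i" using assms(1) by (auto simp: nonpar_def)
    then show ?thesis using i by (simp add: c_def field_simps)
  qed
  then have "y = c *\<^sub>R x" by (simp add: fun_eq_iff)
  then show ?thesis by (rule that)
qed

text \<open>Every two by two minor is multiplied by the determinant
  \<open>a * d - b * c\<close>.\<close>

lemma nonpar_comb:
  "nonpar (a *\<^sub>R x + b *\<^sub>R y) (c *\<^sub>R x + d *\<^sub>R y) \<longleftrightarrow> a * d - b * c \<noteq> 0 \<and> nonpar x y"
proof -
  have "(a * x i + b * y i) * (c * x j + d * y j) - (a * x j + b * y j) * (c * x i + d * y i)
    = (a * d - b * c) * (x i * y j - x j * y i)" for i j
    by (simp add: algebra_simps)
  then have "(a * x i + b * y i) * (c * x j + d * y j) \<noteq> (a * x j + b * y j) * (c * x i + d * y i)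
    \<longleftrightarrow> (a * d - b * c) * (x i * y j - x j * y i) \<noteq> 0" for i j
    by (metis eq_iff_diff_eq_0)
  then show ?thesis by (auto simp: nonpar_def)
qed

lemma nonpar_comb': "nonpar x y \<Longrightarrow> nonpar x (c *\<^sub>R x + d *\<^sub>R y) \<longleftrightarrow> d \<noteq> 0"
  using nonpar_comb[of 1 x 0 y c d] by simp

section \<open>Coordinates on the symmetric matrices over two vectors\<close>

definition qcomb :: "('i \<Rightarrow> real) \<Rightarrow> ('i \<Rightarrow> real) \<Rightarrow> r3 \<Rightarrow> 'i \<Rightarrow> 'i \<Rightarrow> real" where
  "qcomb x y = (\<lambda>(a, b, c). a *\<^sub>R sq x + b *\<^sub>R sprod x y + c *\<^sub>R sq y)"

lemma qcomb_add: "qcomb x y (u + v) = qcomb x y u + qcomb x y v"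
  and qcomb_diff: "qcomb x y (u - v) = qcomb x y u - qcomb x y v"
  and qcomb_scaleR: "qcomb x y (t *\<^sub>R u) = t *\<^sub>R qcomb x y u"
  and qcomb_zero: "qcomb x y 0 = 0"
  by (cases u; cases v; simp add: qcomb_def scaleR_add_left scaleR_diff_left scaleR_add_right zero_prod_def)+

text \<open>Evaluating the quadratic form at the vector supported on \<open>i, j\<close> that
  annihilates \<open>y\<close> gives \<open>a * (e * e)\<close>; likewise with \<open>x\<close> for
  \<open>c\<close>. Then the remaining entries give \<open>b\<close>.\<close>

lemma qcomb_eq_0:
  assumes "nonpar x y" "qcomb x y u = 0"
  shows "u = 0"
proof -
  obtain a b c where u: "u = (a, b, c)" by (cases u)
  obtain i j where ij: "x i * y j \<noteq> x j * y i" using assms(1) by (auto simp: nonpar_def)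
  define e where "e = x i * y j - x j * y i"
  have e: "e \<noteq> 0" using ij by (simp add: e_def)
  have z: "a * (x k * x l) + b * (x k * y l + y k * x l) + c * (y k * y l) = 0" for k l
    using fun_cong[OF fun_cong[OF assms(2)], of k l] by (simp add: u qcomb_def sq_def sprod_def)
  have "a * (e * e) = 0"
  proof -
    have "a * (e * e) = y j * y j * (a * (x i * x i) + b * (x i * y i + y i * x i) + c * (y i * y i))
      - 2 * y i * y j * (a * (x i * x j) + b * (x i * y j + y i * x j) + c * (y i * y j))
      + y i * y i * (a * (x j * x j) + b * (x j * y j + y j * x j) + c * (y j * y j))"
      by (simp add: e_def algebra_simps)
    then show ?thesis unfolding z by simp
  qed
  then have a: "a = 0" using e by simp
  have "c * (e * e) = 0"
  proof -
    have "c * (e * e) = x j * x j * (a * (x i * x i) + b * (x i * y i + y i * x i) + c * (y i * y i))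
      - 2 * x i * x j * (a * (x i * x j) + b * (x i * y j + y i * x j) + c * (y i * y j))
      + x i * x i * (a * (x j * x j) + b * (x j * y j + y j * x j) + c * (y j * y j))"
      by (simp add: e_def algebra_simps)
    then show ?thesis unfolding z by simp
  qed
  then have c: "c = 0" using e by simp
  have "b * (e * e) = 0"
  proof -
    have "b * (x i * y i) = 0" "b * (x j * y j) = 0" "b * (x i * y j + y i * x j) = 0"
      using z[of i i] z[of j j] z[of i j] by (simp_all add: a c)
    then show ?thesis using e unfolding e_def by auto
  qed
  then show ?thesis using e by (simp add: a c u zero_prod_def)
qed

text \<open>The minor on rows and columns \<open>i, j\<close> is \<open>qf u\<close> times a nonzero
  square, and such minors of a rank one matrix vanish.\<close>

lemma qcomb_rank_le1_imp_null:
  assumes "nonpar x y" "rank_le1 (qcomb x y u)"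
  shows "qf u = 0"
proof -
  obtain a b c where u: "u = (a, b, c)" by (cases u)
  obtain t z where tz: "qcomb x y u = t *\<^sub>R sq z" using assms(2) by (auto simp: rank_le1_def)
  have M: "a * (x k * x l) + b * (x k * y l + y k * x l) + c * (y k * y l) = t * (z k * z l)" for k l
    using fun_cong[OF fun_cong[OF tz], of k l] by (simp add: u qcomb_def sq_def sprod_def)
  obtain i j where ij: "x i * y j - x j * y i \<noteq> 0" using assms(1) by (auto simp: nonpar_def)
  have "(a * c - b * b) * ((x i * y j - x j * y i) * (x i * y j - x j * y i))
    = (a * (x i * x i) + b * (x i * y i + y i * x i) + c * (y i * y i))
      * (a * (x j * x j) + b * (x j * y j + y j * x j) + c * (y j * y j))
      - (a * (x i * x j) + b * (x i * y j + y i * x j) + c * (y i * y j))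
      * (a * (x i * x j) + b * (x i * y j + y i * x j) + c * (y i * y j))"
    by (simp add: algebra_simps)
  also have "\<dots> = 0" unfolding M by (simp add: algebra_simps)
  finally show ?thesis using ij by (simp add: u qf_def)
qed

lemma null_coords:
  assumes "qf u = 0" "u \<noteq> 0"
  obtains t \<alpha> \<beta> where "t \<noteq> 0" "u = (t * (\<alpha> * \<alpha>), t * (\<alpha> * \<beta>), t * (\<beta> * \<beta>))" "\<alpha> \<noteq> 0 \<or> \<beta> \<noteq> 0"
proof -
  obtain a b c where u: "u = (a, b, c)" by (cases u)
  have q: "a * c = b * b" using assms(1) by (simp add: u qf_def)
  show ?thesis
  proof (cases "a = 0")
    case True
    then show ?thesis using that[of c 0 1] q assms(2) by (auto simp: u zero_prod_def)
  next
    case False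
    then have "c = a * (b / a * (b / a))" using q by (simp add: field_simps)
    then show ?thesis using that[of a 1 "b / a"] False by (simp add: u)
  qed
qed

lemma qcomb_coords: "qcomb x y (t * (\<alpha> * \<alpha>), t * (\<alpha> * \<beta>), t * (\<beta> * \<beta>)) = t *\<^sub>R sq (\<alpha> *\<^sub>R x + \<beta> *\<^sub>R y)"
  by (simp add: qcomb_def sq_def sprod_def fun_eq_iff algebra_simps)

text \<open>Converse direction to \<open>qcomb_rank_le1_imp_null\<close>: a nonzero null triple is a
  multiple of a square of a pair, hence comes from a rank one matrix.\<close>

lemma qcomb_null_obtain:
  assumes "qf u = 0" "u \<noteq> 0" "nonpar x y"
  obtains t \<alpha> \<beta> where "t \<noteq> 0" "qcomb x y u = t *\<^sub>R sq (\<alpha> *\<^sub>R x + \<beta> *\<^sub>R y)"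
    "\<alpha> *\<^sub>R x + \<beta> *\<^sub>R y \<noteq> 0" "u = (t * (\<alpha> * \<alpha>), t * (\<alpha> * \<beta>), t * (\<beta> * \<beta>))"
proof -
  obtain t \<alpha> \<beta> where t: "t \<noteq> 0" "u = (t * (\<alpha> * \<alpha>), t * (\<alpha> * \<beta>), t * (\<beta> * \<beta>))" "\<alpha> \<noteq> 0 \<or> \<beta> \<noteq> 0"
    using null_coords[OF assms(1,2)] .
  have g: "qcomb x y u = t *\<^sub>R sq (\<alpha> *\<^sub>R x + \<beta> *\<^sub>R y)" unfolding t(2) by (rule qcomb_coords)
  have "qcomb x y u \<noteq> 0" using qcomb_eq_0[OF assms(3)] assms(2) by blast
  then have "\<alpha> *\<^sub>R x + \<beta> *\<^sub>R y \<noteq> 0" unfolding g by (auto simp: sq_zero)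
  then show ?thesis using that t g by blast
qed

text \<open>If \<open>K\<close> had a direction \<open>z\<close> independent of \<open>x\<close>,
  the difference would have coordinates \<open>(- t, 0, s)\<close> in their slice, whose determinant
  \<open>- t * s\<close> must vanish.\<close>

lemma rank_le1_collinear:
  assumes "t \<noteq> 0" "x \<noteq> 0" "rank_le1 K" "rank_le1 (K - t *\<^sub>R sq x)"
  obtains s where "K = s *\<^sub>R sq x"
proof -
  obtain s z where K: "K = s *\<^sub>R sq z" using assms(3) by (auto simp: rank_le1_def)
  show ?thesis
  proof (cases "nonpar x z")
    case False
    then obtain c where "z = c *\<^sub>R x" using not_nonpar assms(2) by blast
    then show ?thesis using that[of "s * (c * c)"] by (simp add: K sq_scaleR)
  next
    case True
    have "K - t *\<^sub>R sq x = qcomb x z (- t, 0, s)" by (simp add: K qcomb_def)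
    then have "qf (- t, 0, s) = 0" using qcomb_rank_le1_imp_null[OF True] assms(4) by simp
    then have "s = 0" using assms(1) by (simp add: qf_def)
    then show ?thesis using that[of 0] by (simp add: K)
  qed
qed

text \<open>Both sides have the same nonzero minor on \<open>i, j\<close>, so \<open>r * e\<close>
  is nonzero and \<open>u\<close> can be solved for from columns \<open>i\<close> and
  \<open>j\<close>, which lie in the span of \<open>x\<close> and \<open>y\<close>.\<close>

lemma sq_comb_in_span:
  assumes "nonpar x y" "a \<noteq> 0" "b \<noteq> 0" "r *\<^sub>R sq u + s *\<^sub>R sq v = a *\<^sub>R sq x + b *\<^sub>R sq y"
  obtains \<alpha> \<beta> where "u = \<alpha> *\<^sub>R x + \<beta> *\<^sub>R y"
proof -
  have M: "r * (u k * u l) + s * (v k * v l) = a * (x k * x l) + b * (y k * y l)" for k l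
    using fun_cong[OF fun_cong[OF assms(4)], of k l] by (simp add: sq_def)
  obtain i j where ij: "x i * y j - x j * y i \<noteq> 0" using assms(1) by (auto simp: nonpar_def)
  define e where "e = u i * v j - u j * v i"
  have "r * s * (e * e) = (r * (u i * u i) + s * (v i * v i)) * (r * (u j * u j) + s * (v j * v j))
    - (r * (u i * u j) + s * (v i * v j)) * (r * (u i * u j) + s * (v i * v j))"
    by (simp add: e_def algebra_simps)
  also have "\<dots> = a * b * ((x i * y j - x j * y i) * (x i * y j - x j * y i))"
    unfolding M by (simp add: algebra_simps)
  finally have nz: "r * e \<noteq> 0" using ij assms(2,3) by auto
  have "r * e * u k = (a * (v j * x i - v i * x j)) * x k + (b * (v j * y i - v i * y j)) * y k" for k
  proof -
    have "r * e * u k = v j * (r * (u k * u i) + s * (v k * v i)) - v i * (r * (u k * u j) + s * (v k * v j))"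
      by (simp add: e_def algebra_simps)
    also have "\<dots> = v j * (a * (x k * x i) + b * (y k * y i)) - v i * (a * (x k * x j) + b * (y k * y j))"
      by (simp only: M)
    finally show ?thesis by (simp add: algebra_simps)
  qed
  then have "u k = (a * (v j * x i - v i * x j) / (r * e)) * x k + (b * (v j * y i - v i * y j) / (r * e)) * y k" for k
    using nz by (metis (no_types, lifting) add_divide_distrib nonzero_mult_div_cancel_left times_divide_eq_left)
  then have "u = (a * (v j * x i - v i * x j) / (r * e)) *\<^sub>R x + (b * (v j * y i - v i * y j) / (r * e)) *\<^sub>R y"
    by (simp add: fun_eq_iff)
  then show ?thesis by (rule that)
qed

section \<open>Collapsing slices\<close>

text \<open>Every nonzero point lies on a null line with all but finitely many points generic, so
  two of them put it into \<open>S\<close>.\<close>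

lemma null_line_closed_eq_UNIV:
  assumes closed: "\<And>P Q R. P \<in> S \<Longrightarrow> Q \<in> S \<Longrightarrow> P \<noteq> Q \<Longrightarrow> qf (P - Q) = 0 \<Longrightarrow> qf (R - P) = 0 \<Longrightarrow> qf (R - Q) = 0 \<Longrightarrow> R \<in> S"
    and zero: "0 \<in> S"
    and generic: "\<And>p b r. p \<noteq> 0 \<Longrightarrow> b \<noteq> 0 \<Longrightarrow> r \<noteq> 0 \<Longrightarrow> p * r - b * b \<noteq> 0 \<Longrightarrow> (p, b, r) \<in> S"
  shows "x \<in> S"
proof (cases "x = 0")
  case False
  obtain p b r where x: "x = (p, b, r)" by (cases x)
  \<comment> \<open>The expression is the slope of \<open>qf\<close> along the line through
    \<open>x\<close> in the null direction \<open>(1, k, k^2)\<close>. It cannot vanish at all of 1,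
    -1 and 2.\<close>
  have "\<exists>k. k \<noteq> 0 \<and> r + k * k * p - 2 * k * b \<noteq> 0"
  proof (rule ccontr)
    assume "\<not> ?thesis"
    then have "r + 1 * 1 * p - 2 * 1 * b = 0" "r + (- 1) * (- 1) * p - 2 * (- 1) * b = 0"
      "r + 2 * 2 * p - 2 * 2 * b = 0" by (metis zero_neq_one, metis neg_equal_0_iff_equal zero_neq_one, metis zero_neq_numeral)
    then have "b = 0" "p = 0" "r = 0" by auto
    then show False using False by (simp add: x zero_prod_def)
  qed
  then obtain k where k: "k \<noteq> 0" "r + k * k * p - 2 * k * b \<noteq> 0" by blast
  define E where "E = r + k * k * p - 2 * k * b"
  define pt where "pt s = (p + s, b + s * k, r + s * (k * k))" for s
  \<comment> \<open>The parameters where one of the four conditions in \<open>generic\<close>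
    fails.\<close>
  define B where "B = {- p, - b / k, - r / (k * k), - (p * r - b * b) / E}"
  have good: "pt s \<in> S" if "s \<notin> B" for s
    unfolding pt_def
  proof (rule generic)
    show "p + s \<noteq> 0" "b + s * k \<noteq> 0" "r + s * (k * k) \<noteq> 0"
      using that k by (auto simp: B_def field_simps eq_neg_iff_add_eq_0)
    have "(p + s) * (r + s * (k * k)) - (b + s * k) * (b + s * k) = (p * r - b * b) + s * E"
      by (simp add: E_def algebra_simps)
    also have "\<dots> \<noteq> 0"
    proof
      assume "p * r - b * b + s * E = 0"
      then have "s * E = - (p * r - b * b)" by simp
      then have "s = - (p * r - b * b) / E" using k by (simp add: E_def eq_divide_eq)
      then show False using that by (simp add: B_def)
    qed
    finally show "(p + s) * (r + s * (k * k)) - (b + s * k) * (b + s * k) \<noteq> 0" .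
  qed
  have fin: "finite B" by (simp add: B_def)
  obtain s where s: "s \<notin> B" using ex_new_if_finite[OF infinite_UNIV_char_0 fin] by blast
  obtain t where t: "t \<notin> insert s B" using ex_new_if_finite[OF infinite_UNIV_char_0, of "insert s B"] fin by blast
  show ?thesis
  proof (rule closed[of "pt s" "pt t"])
    show "pt s \<in> S" "pt t \<in> S" using s t good by auto
    show "pt s \<noteq> pt t" using t by (auto simp: pt_def)
  qed (simp_all add: pt_def x qf_def algebra_simps)
qed (use zero in simp)

text \<open>A generic point has null differences to a point on each coordinate axis. If these two
  have different images, both on the line of \<open>y\<close>, then
  \<open>rank_le1_collinear\<close> puts the generic point there too.\<close>

lemma collapse:
  fixes \<Psi> :: "r3 \<Rightarrow> 'i \<Rightarrow> 'i \<Rightarrow> real"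
  assumes adj: "\<And>x y. qf (x - y) = 0 \<Longrightarrow> x \<noteq> y \<Longrightarrow> \<Psi> x \<noteq> \<Psi> y \<and> rank_le1 (\<Psi> x - \<Psi> y)"
    and e1: "\<Psi> (1, 0, 0) = \<Psi> 0 + t1 *\<^sub>R sq y" and e2: "\<Psi> (0, 0, 1) = \<Psi> 0 + t2 *\<^sub>R sq y"
  shows "\<exists>t. \<Psi> x = \<Psi> 0 + t *\<^sub>R sq y"
proof -
  define S where "S = {x. \<exists>t. \<Psi> x = \<Psi> 0 + t *\<^sub>R sq y}"
  \<comment> \<open>Only the images of \<open>P\<close> and \<open>Q\<close> must differ;
    \<open>P - Q\<close> may fail to be null, as happens for points on different axes.\<close>
  have LL: "R \<in> S" if P: "P \<in> S" and Q: "Q \<in> S" and PQ: "\<Psi> P \<noteq> \<Psi> Q" and RP: "qf (R - P) = 0" and RQ: "qf (R - Q) = 0" for P Q R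
  proof (cases "R = P \<or> R = Q")
    case False
    obtain a b where a: "\<Psi> P = \<Psi> 0 + a *\<^sub>R sq y" and b: "\<Psi> Q = \<Psi> 0 + b *\<^sub>R sq y"
      using P Q by (auto simp: S_def)
    have y0: "y \<noteq> 0" "b - a \<noteq> 0" using PQ a b by (auto simp: sq_zero)
    have "rank_le1 (\<Psi> R - \<Psi> P)" "rank_le1 (\<Psi> R - \<Psi> Q)" using adj[OF RP] adj[OF RQ] False by auto
    moreover have "\<Psi> R - \<Psi> Q = (\<Psi> R - \<Psi> P) - (b - a) *\<^sub>R sq y"
      by (simp add: a b scaleR_left_diff_distrib)
    ultimately obtain s where "\<Psi> R - \<Psi> P = s *\<^sub>R sq y"
      using rank_le1_collinear[OF y0(2,1), of "\<Psi> R - \<Psi> P"] by metis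
    then have "\<Psi> R = \<Psi> 0 + (a + s) *\<^sub>R sq y" by (simp add: a scaleR_add_left algebra_simps)
    then show ?thesis by (auto simp: S_def)
  qed (use P Q in auto)
  have S0: "0 \<in> S" by (auto simp: S_def intro: exI[of _ 0])
  have ne: "\<Psi> P \<noteq> \<Psi> Q" if "qf (P - Q) = 0" "P \<noteq> Q" for P Q using adj[OF that] by simp
  have ax1: "(a, 0, 0) \<in> S" for a
  proof (rule LL[OF S0, of "(1, 0, 0)"])
    show "\<Psi> 0 \<noteq> \<Psi> (1, 0, 0)" by (rule ne) (auto simp: qf_def zero_prod_def)
  qed (use e1 in \<open>auto simp: S_def qf_def zero_prod_def\<close>)
  have ax2: "(0, 0, a) \<in> S" for a
  proof (rule LL[OF S0, of "(0, 0, 1)"])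
    show "\<Psi> 0 \<noteq> \<Psi> (0, 0, 1)" by (rule ne) (auto simp: qf_def zero_prod_def)
  qed (use e2 in \<open>auto simp: S_def qf_def zero_prod_def\<close>)
  have "x \<in> S"
  proof (rule null_line_closed_eq_UNIV[OF _ S0])
    fix p b r :: real assume nz: "p \<noteq> 0" "b \<noteq> 0" "r \<noteq> 0" "p * r - b * b \<noteq> 0"
    \<comment> \<open>Chosen so that \<open>(p, b, r) - (a, 0, 0)\<close> is null. Below,
      \<open>pt\<close> runs along the joining line and \<open>(0, 0, c s)\<close> is the point of
      the second axis at null distance from \<open>pt s\<close>.\<close>
    define a where "a = (p * r - b * b) / r"
    have a: "a \<noteq> 0" "a * r = p * r - b * b" using nz by (auto simp: a_def)
    then have ap: "(p - a) * r = b * b" by (simp add: algebra_simps)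
    then have pa: "p \<noteq> a" using nz by auto
    define pt where "pt s = (a + s * (p - a), s * b, s * r)" for s
    define c where "c s = s * r * a / (a + s * (p - a))" for s
    have pt1: "qf (pt s - (a, 0, 0)) = 0" for s
    proof -
      have "qf (pt s - (a, 0, 0)) = s * s * ((p - a) * r - b * b)" by (simp add: pt_def qf_def algebra_simps)
      then show ?thesis using ap by simp
    qed
    have pt2: "qf (pt s - (0, 0, c s)) = 0" if "a + s * (p - a) \<noteq> 0" for s
    proof -
      have "(a + s * (p - a)) * c s = s * r * a" using that by (simp add: c_def)
      then have "qf (pt s - (0, 0, c s)) = s * s * ((p - a) * r - b * b)"
        by (simp add: pt_def qf_def algebra_simps)
      then show ?thesis using ap by simp
    qed
    have gd: "pt s \<in> S" if "a + s * (p - a) \<noteq> 0" "\<Psi> (a, 0, 0) \<noteq> \<Psi> (0, 0, c s)" for s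
      using LL[OF ax1 ax2 that(2) pt1 pt2[OF that(1)]] .
    have "pt 1 \<in> S"
    proof (cases "\<Psi> (a, 0, 0) = \<Psi> (0, 0, c 1)")
      case False
      then show ?thesis using gd[of 1] nz by simp
    next
      case True
      \<comment> \<open>If the two axis points have equal images, another point \<open>pt s\<close>
        of the same null line has a partner with a different image. It lies in \<open>S\<close>, and
        so does the line through it and \<open>(a, 0, 0)\<close>.\<close>
      obtain s where s: "s \<notin> {0, 1, a / (a - p)}"
        using ex_new_if_finite[OF infinite_UNIV_char_0, of "{0, 1, a / (a - p)}"] by blast
      have s1: "a + s * (p - a) \<noteq> 0"
      proof
        assume "a + s * (p - a) = 0"
        then have "s * (a - p) = a" by (simp add: algebra_simps)
        then have "s = a / (a - p)" using pa by (simp add: eq_divide_eq)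
        then show False using s by simp
      qed
      have "c s \<noteq> c 1"
      proof
        assume "c s = c 1"
        then have "s * r * a * p = r * a * (a + s * (p - a))" using s1 nz
          by (simp add: c_def frac_eq_eq)
        then have "r * a * a * (s - 1) = 0" by (simp add: algebra_simps)
        then show False using nz a s by simp
      qed
      then have "\<Psi> (0, 0, c s) \<noteq> \<Psi> (0, 0, c 1)" by (intro ne) (auto simp: qf_def)
      then have "pt s \<in> S" using gd[OF s1] True by simp
      moreover have "qf (pt 1 - pt s) = 0"
      proof -
        have "qf (pt 1 - pt s) = (1 - s) * (1 - s) * ((p - a) * r - b * b)" by (simp add: pt_def qf_def algebra_simps)
        then show ?thesis using ap by simp
      qed
      moreover have "pt s \<noteq> (a, 0, 0)" using s nz by (simp add: pt_def)
      ultimately show ?thesis using LL[of "pt s" "(a, 0, 0)" "pt 1"] ax1 ne[OF pt1] pt1 by blast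
    qed
    then show "(p, b, r) \<in> S" by (simp add: pt_def)
  qed (use LL ne in blast)
  then show ?thesis by (simp add: S_def)
qed

lemma qcomb_change:
  "qcomb (a *\<^sub>R p + b *\<^sub>R q) (c *\<^sub>R p + d *\<^sub>R q) (x, y, z) =
    qcomb p q (x * a * a + 2 * y * a * c + z * c * c, x * a * b + y * (a * d + b * c) + z * c * d,
      x * b * b + 2 * y * b * d + z * d * d)"
  by (simp add: qcomb_def sq_def sprod_def fun_eq_iff algebra_simps)

text \<open>The matrices at \<open>s = 1\<close> and \<open>s = - 1\<close> add up to a combination
  of \<open>sq y'\<close> and \<open>sq y\<close>, which forces \<open>M\<close> into their slice.
  The null condition at 1, -1 and 2 then kills the diagonal coordinates of \<open>M\<close>.\<close>

lemma quadratic_pencil_rank_le1: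
  assumes "nonpar y y'" "h \<noteq> 0" "f \<noteq> 0"
    and r: "\<And>s. rank_le1 (h *\<^sub>R sq y' + s *\<^sub>R M + (s * s) *\<^sub>R (f *\<^sub>R sq y))"
  obtains \<beta> where "M = \<beta> *\<^sub>R sprod y y'" "\<beta> * \<beta> = h * f"
proof -
  have ind': "nonpar y' y" using assms(1) by (simp add: nonpar_commute)
  obtain t u where u: "h *\<^sub>R sq y' + M + f *\<^sub>R sq y = t *\<^sub>R sq u" using r[of 1] by (auto simp: rank_le1_def)
  obtain t' v where v: "h *\<^sub>R sq y' - M + f *\<^sub>R sq y = t' *\<^sub>R sq v" using r[of "- 1"] by (auto simp: rank_le1_def)
  have "t *\<^sub>R sq u + t' *\<^sub>R sq v = (2 * h) *\<^sub>R sq y' + (2 * f) *\<^sub>R sq y"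
    unfolding u[symmetric] v[symmetric] by (simp add: fun_eq_iff)
  then obtain \<alpha> \<gamma> where uu: "u = \<alpha> *\<^sub>R y' + \<gamma> *\<^sub>R y"
    using sq_comb_in_span[OF ind'] assms(2,3) by (metis mult_eq_0_iff zero_neq_numeral)
  define a b c where "a = t * (\<alpha> * \<alpha>) - h" and "b = t * (\<alpha> * \<gamma>)" and "c = t * (\<gamma> * \<gamma>) - f"
  have "M = t *\<^sub>R sq u - h *\<^sub>R sq y' - f *\<^sub>R sq y" unfolding u[symmetric] by simp
  also have "\<dots> = qcomb y' y (a, b, c)"
    unfolding uu by (simp add: qcomb_def a_def b_def c_def sq_def sprod_def fun_eq_iff algebra_simps)
  finally have M: "M = qcomb y' y (a, b, c)" .
  have "qf (h + s * a, s * b, s * s * f + s * c) = 0" for s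
  proof (rule qcomb_rank_le1_imp_null[OF ind'])
    have "qcomb y' y (h + s * a, s * b, s * s * f + s * c) = h *\<^sub>R sq y' + s *\<^sub>R M + (s * s) *\<^sub>R (f *\<^sub>R sq y)"
      unfolding M by (simp add: qcomb_def fun_eq_iff algebra_simps)
    then show "rank_le1 (qcomb y' y (h + s * a, s * b, s * s * f + s * c))" using r by simp
  qed
  then have q: "(h + s * a) * (s * s * f + s * c) = s * b * (s * b)" for s by (simp add: qf_def)
  have "h * c + a * f = 0" "h * f + a * c = b * b" "h * c + 4 * (a * f) = 0"
    using q[of 1] q[of "- 1"] q[of 2] by (simp_all add: algebra_simps)
  moreover from this have "a * f = 0" by linarith
  ultimately have "a = 0" "c = 0" "b * b = h * f" using assms(2,3) by auto
  then show ?thesis using that[of b] M by (simp add: qcomb_def sprod_commute)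
qed

section \<open>Adjacency preserving maps\<close>

locale adj_map =
  fixes U :: "('i \<Rightarrow> real) set" and \<Phi> :: "('i \<Rightarrow> 'i \<Rightarrow> real) \<Rightarrow> ('j \<Rightarrow> 'j \<Rightarrow> real)"
  assumes U: "subspace U"
    and adj: "\<And>A x t. A \<in> span (sq ` U) \<Longrightarrow> x \<in> U \<Longrightarrow> x \<noteq> 0 \<Longrightarrow> t \<noteq> 0 \<Longrightarrow>
      \<Phi> (A + t *\<^sub>R sq x) \<noteq> \<Phi> A \<and> rank_le1 (\<Phi> (A + t *\<^sub>R sq x) - \<Phi> A)"
begin

abbreviation "S \<equiv> span (sq ` U)"

lemma U_comb: "p \<in> U \<Longrightarrow> q \<in> U \<Longrightarrow> a *\<^sub>R p + b *\<^sub>R q \<in> U"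
  using U by (simp add: subspace_add subspace_scale)

lemma S_sq: "x \<in> U \<Longrightarrow> t *\<^sub>R sq x \<in> S"
  by (simp add: span_base span_scale)

lemma S_qcomb:
  assumes "p \<in> U" "q \<in> U"
  shows "qcomb p q u \<in> S"
proof -
  obtain a b c where u: "u = (a, b, c)" by (cases u)
  have "qcomb p q u = (a - b) *\<^sub>R sq p + b *\<^sub>R sq (p + q) + (c - b) *\<^sub>R sq q"
    by (simp add: u qcomb_def sq_def sprod_def fun_eq_iff algebra_simps)
  also have "\<dots> \<in> S" using assms U by (intro span_add S_sq) (auto simp: subspace_add)
  finally show ?thesis .
qed

lemma sq_qcomb: "sq p = qcomb p q (1, 0, 0)" "sq q = qcomb p q (0, 0, 1)"
  by (simp_all add: qcomb_def)

lemma adj_qcomb: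
  assumes "A \<in> S" "p \<in> U" "q \<in> U" "nonpar p q" "qf (u - v) = 0" "u \<noteq> v"
  shows "\<Phi> (A + qcomb p q u) \<noteq> \<Phi> (A + qcomb p q v) \<and> rank_le1 (\<Phi> (A + qcomb p q u) - \<Phi> (A + qcomb p q v))"
proof -
  have "u - v \<noteq> 0" using assms(6) by simp
  then obtain t \<alpha> \<beta> where t: "t \<noteq> 0" "qcomb p q (u - v) = t *\<^sub>R sq (\<alpha> *\<^sub>R p + \<beta> *\<^sub>R q)"
    "\<alpha> *\<^sub>R p + \<beta> *\<^sub>R q \<noteq> 0" by (rule qcomb_null_obtain[OF assms(5) _ assms(4)])
  have e: "A + qcomb p q u = (A + qcomb p q v) + t *\<^sub>R sq (\<alpha> *\<^sub>R p + \<beta> *\<^sub>R q)"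
    unfolding t(2)[symmetric] by (simp add: qcomb_diff)
  show ?thesis unfolding e
    by (rule adj) (use t assms in \<open>simp_all add: span_add S_qcomb U_comb\<close>)
qed

text \<open>Images of three points of a line are pairwise adjacent, so
  \<open>rank_le1_collinear\<close> keeps the third on the line of the first two.\<close>

lemma line:
  assumes "A \<in> S" "x \<in> U" "t \<noteq> 0" "\<Phi> (A + t *\<^sub>R sq x) = \<Phi> A + a *\<^sub>R sq y"
  shows "\<exists>s. \<Phi> (A + t' *\<^sub>R sq x) = \<Phi> A + s *\<^sub>R sq y"
proof -
  consider "x = 0 \<or> t' = 0" | "t' = t" | "x \<noteq> 0" "t' \<noteq> 0" "t' \<noteq> t" by blast
  then show ?thesis
  proof cases
    case 1
    then show ?thesis by (auto simp: sq_zero intro: exI[of _ 0])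
  next
    case 2
    then show ?thesis using assms(4) by blast
  next
    case 3
    have a: "a \<noteq> 0" "y \<noteq> 0" using adj[OF assms(1,2) 3(1) assms(3)] assms(4) by (auto simp: sq_zero)
    have e: "A + t *\<^sub>R sq x + (t' - t) *\<^sub>R sq x = A + t' *\<^sub>R sq x" by (simp add: scaleR_diff_left)
    have "rank_le1 (\<Phi> (A + t *\<^sub>R sq x + (t' - t) *\<^sub>R sq x) - \<Phi> (A + t *\<^sub>R sq x))"
      using adj[of "A + t *\<^sub>R sq x" x "t' - t"] assms 3 by (simp add: span_add S_sq)
    then have "rank_le1 (\<Phi> (A + t' *\<^sub>R sq x) - \<Phi> A - a *\<^sub>R sq y)" unfolding e assms(4) by (simp add: diff_diff_add)
    moreover have "rank_le1 (\<Phi> (A + t' *\<^sub>R sq x) - \<Phi> A)" using adj[OF assms(1,2) 3(1,2)] by simp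
    ultimately obtain s where "\<Phi> (A + t' *\<^sub>R sq x) - \<Phi> A = s *\<^sub>R sq y" using rank_le1_collinear[OF a] by blast
    then have "\<Phi> (A + t' *\<^sub>R sq x) = \<Phi> A + s *\<^sub>R sq y" by (simp add: algebra_simps)
    then show ?thesis ..
  qed
qed

lemma direction:
  assumes "A \<in> S" "x \<in> U" "x \<noteq> 0"
  obtains f y where "\<Phi> (A + sq x) = \<Phi> A + f *\<^sub>R sq y" "f \<noteq> 0" "y \<noteq> 0"
proof -
  have 1: "\<Phi> (A + sq x) \<noteq> \<Phi> A" "rank_le1 (\<Phi> (A + sq x) - \<Phi> A)" using adj[OF assms, of 1] by auto
  then obtain f y where "\<Phi> (A + sq x) - \<Phi> A = f *\<^sub>R sq y" by (auto simp: rank_le1_def)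
  then have e: "\<Phi> (A + sq x) = \<Phi> A + f *\<^sub>R sq y" by (simp add: algebra_simps)
  moreover have "f \<noteq> 0" "y \<noteq> 0" using 1(1) e by (auto simp: sq_zero)
  ultimately show ?thesis by (rule that)
qed

section \<open>Slices with equal and with different image directions\<close>

definition aligned where
  "aligned A p q \<longleftrightarrow> (\<exists>y s t. \<Phi> (A + sq p) = \<Phi> A + s *\<^sub>R sq y \<and> \<Phi> (A + sq q) = \<Phi> A + t *\<^sub>R sq y)"

lemma aligned_sym: "aligned A p q \<Longrightarrow> aligned A q p"
  unfolding aligned_def by blast

text \<open>The image moves along \<open>p\<close>, so its direction is determined up to a factor,
  and any representative \<open>y\<close> serves \<open>q\<close> as well.\<close>

lemma aligned_line:
  assumes "aligned A p q" "\<Phi> (A + sq p) = \<Phi> A + s *\<^sub>R sq y" "p \<noteq> 0" "A \<in> S" "p \<in> U"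
  shows "\<exists>t. \<Phi> (A + sq q) = \<Phi> A + t *\<^sub>R sq y"
proof -
  obtain z f g where z: "\<Phi> (A + sq p) = \<Phi> A + f *\<^sub>R sq z" "\<Phi> (A + sq q) = \<Phi> A + g *\<^sub>R sq z"
    using assms(1) by (auto simp: aligned_def)
  have e: "f *\<^sub>R sq z = s *\<^sub>R sq y" using z(1) assms(2) by simp
  have "\<Phi> (A + sq p) \<noteq> \<Phi> A" using adj[of A p 1] assms by simp
  then have "f \<noteq> 0" using z(1) by auto
  then have "g *\<^sub>R sq z = (g / f) *\<^sub>R (f *\<^sub>R sq z)" by simp
  then have "\<Phi> (A + sq q) = \<Phi> A + (g / f * s) *\<^sub>R sq y" unfolding z(2) e by simp
  then show ?thesis ..
qed

lemma aligned_trans: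
  assumes "aligned A p q" "aligned A q r" "q \<noteq> 0" "A \<in> S" "q \<in> U"
  shows "aligned A p r"
proof -
  obtain z f g where z: "\<Phi> (A + sq p) = \<Phi> A + f *\<^sub>R sq z" "\<Phi> (A + sq q) = \<Phi> A + g *\<^sub>R sq z"
    using assms(1) by (auto simp: aligned_def)
  then show ?thesis using aligned_line[OF assms(2) z(2) assms(3-5)] by (auto simp: aligned_def)
qed

lemma collapse_qcomb:
  assumes "A \<in> S" "p \<in> U" "q \<in> U" "nonpar p q"
    "\<Phi> (A + sq p) = \<Phi> A + s *\<^sub>R sq y" "\<Phi> (A + sq q) = \<Phi> A + t *\<^sub>R sq y"
  shows "\<exists>r. \<Phi> (A + qcomb p q u) = \<Phi> A + r *\<^sub>R sq y"
  using collapse[of "\<lambda>u. \<Phi> (A + qcomb p q u)" s y t u] adj_qcomb[OF assms(1-4)] assms(5,6)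
  by (simp add: qcomb_zero flip: sq_qcomb)

definition separated where
  "separated A p q \<longleftrightarrow> A \<in> S \<and> p \<in> U \<and> q \<in> U \<and> nonpar p q \<and> \<not> aligned A p q"

lemma separated_sym: "separated A p q \<Longrightarrow> separated A q p"
  unfolding separated_def using aligned_sym nonpar_commute by blast

text \<open>Alignment at any point and for any basis of the slice would collapse the whole slice,
  including the images of \<open>A\<close>, \<open>A + sq p\<close> and
  \<open>A + sq q\<close>.\<close>

lemma separated_move:
  assumes N: "separated A p q" and D: "\<alpha> * \<delta> - \<beta> * \<gamma> \<noteq> 0"
  shows "separated (A + qcomb p q u) (\<alpha> *\<^sub>R p + \<beta> *\<^sub>R q) (\<gamma> *\<^sub>R p + \<delta> *\<^sub>R q)"
proof -
  define A' p' q' where "A' = A + qcomb p q u" and "p' = \<alpha> *\<^sub>R p + \<beta> *\<^sub>R q" and "q' = \<gamma> *\<^sub>R p + \<delta> *\<^sub>R q"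
  have n: "A \<in> S" "p \<in> U" "q \<in> U" "nonpar p q" "\<not> aligned A p q" using N by (auto simp: separated_def)
  have n': "A' \<in> S" "p' \<in> U" "q' \<in> U" "nonpar p' q'"
    using n D by (auto simp: A'_def p'_def q'_def span_add S_qcomb U_comb nonpar_comb)
  have "\<not> aligned A' p' q'"
  proof
    assume "aligned A' p' q'"
    then obtain y s t where y: "\<Phi> (A' + sq p') = \<Phi> A' + s *\<^sub>R sq y" "\<Phi> (A' + sq q') = \<Phi> A' + t *\<^sub>R sq y"
      by (auto simp: aligned_def)
    define E where "E = \<alpha> * \<delta> - \<beta> * \<gamma>"
    have E: "E \<noteq> 0" using D by (simp add: E_def)
    \<comment> \<open>Cramer's rule recovers \<open>p\<close> and \<open>q\<close>, so both bases
      describe the same slice.\<close>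
    have "(\<alpha> * (\<delta> * p i) - \<beta> * (\<gamma> * p i)) = E * p i" "(\<alpha> * (\<delta> * q i) - \<beta> * (\<gamma> * q i)) = E * q i" for i
      by (simp_all add: E_def algebra_simps)
    then have "E *\<^sub>R p = \<delta> *\<^sub>R p' + (- \<beta>) *\<^sub>R q'" "E *\<^sub>R q = (- \<gamma>) *\<^sub>R p' + \<alpha> *\<^sub>R q'"
      by (simp_all add: p'_def q'_def fun_eq_iff algebra_simps)
    then have "(1 / E) *\<^sub>R (E *\<^sub>R p) = (1 / E) *\<^sub>R (\<delta> *\<^sub>R p' + (- \<beta>) *\<^sub>R q')"
      "(1 / E) *\<^sub>R (E *\<^sub>R q) = (1 / E) *\<^sub>R ((- \<gamma>) *\<^sub>R p' + \<alpha> *\<^sub>R q')" by simp_all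
    then have pq: "p = (\<delta> / E) *\<^sub>R p' + (- \<beta> / E) *\<^sub>R q'" "q = (- \<gamma> / E) *\<^sub>R p' + (\<alpha> / E) *\<^sub>R q'"
      using E by (simp_all add: scaleR_add_right scaleR_diff_right)
    have on: "\<exists>r. \<Phi> (A' + qcomb p q v) = \<Phi> A' + r *\<^sub>R sq y" for v
    proof -
      obtain v1 v2 v3 where v: "v = (v1, v2, v3)" by (cases v)
      show ?thesis unfolding v pq qcomb_change by (rule collapse_qcomb[OF n' y])
    qed
    have "\<exists>r. \<Phi> (A + qcomb p q v) = \<Phi> A' + r *\<^sub>R sq y" for v
      using on[of "v - u"] by (simp add: A'_def qcomb_diff)
    from this[of 0] this[of "(1, 0, 0)"] this[of "(0, 0, 1)"] obtain a b c where
      abc: "\<Phi> A = \<Phi> A' + a *\<^sub>R sq y" "\<Phi> (A + sq p) = \<Phi> A' + b *\<^sub>R sq y" "\<Phi> (A + sq q) = \<Phi> A' + c *\<^sub>R sq y"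
      by (auto simp: qcomb_zero simp flip: sq_qcomb)
    have "\<Phi> (A + sq p) = \<Phi> A + (b - a) *\<^sub>R sq y" "\<Phi> (A + sq q) = \<Phi> A + (c - a) *\<^sub>R sq y"
      unfolding abc by (simp_all add: scaleR_diff_left)
    then have "aligned A p q" unfolding aligned_def by blast
    then show False using n by simp
  qed
  then show ?thesis using n' by (simp add: separated_def A'_def p'_def q'_def)
qed

text \<open>The images of the two axes span a slice that contains the image of the whole slice of
  \<open>p, q\<close>. In coordinates this is a \<open>nondeg_null_map\<close>, and
  \<open>parallelogram\<close> finishes.\<close>

lemma separated_additive:
  assumes N: "separated A p q"
  shows "\<Phi> (A + a *\<^sub>R sq p + c *\<^sub>R sq q) = \<Phi> (A + c *\<^sub>R sq q) + a *\<^sub>R (\<Phi> (A + sq p) - \<Phi> A)"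
proof -
  have n: "A \<in> S" "p \<in> U" "q \<in> U" "nonpar p q" "\<not> aligned A p q" using N by (auto simp: separated_def)
  obtain f1 y1 where 1: "\<Phi> (A + sq p) = \<Phi> A + f1 *\<^sub>R sq y1" "f1 \<noteq> 0" "y1 \<noteq> 0"
    using direction[of A p] n nonpar_nz by metis
  obtain f2 y2 where 2: "\<Phi> (A + sq q) = \<Phi> A + f2 *\<^sub>R sq y2" "f2 \<noteq> 0" "y2 \<noteq> 0"
    using direction[of A q] n nonpar_nz by metis
  have y12: "nonpar y1 y2"
  proof (rule ccontr)
    assume "\<not> nonpar y1 y2"
    then obtain k where "y2 = k *\<^sub>R y1" using not_nonpar 1(3) by metis
    then have "\<Phi> (A + sq q) = \<Phi> A + (f2 * (k * k)) *\<^sub>R sq y1" using 2(1) by (simp add: sq_scaleR)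
    then show False using n(5) 1(1) unfolding aligned_def by blast
  qed
  define F where "F u = \<Phi> (A + qcomb p q u) - \<Phi> A" for u
  have F0: "F 0 = 0" by (simp add: F_def qcomb_zero)
  have Fadj: "F u \<noteq> F v" "rank_le1 (F u - F v)" if "qf (u - v) = 0" "u \<noteq> v" for u v
    using adj_qcomb[OF n(1-4) that] by (auto simp: F_def)
  have ax1: "\<exists>s. F (t, 0, 0) = s *\<^sub>R sq y1" for t
    using line[OF n(1,2), of 1 f1 y1 t] 1 by (auto simp: F_def qcomb_def)
  have ax2: "\<exists>s. F (0, 0, t) = s *\<^sub>R sq y2" for t
    using line[OF n(1,3), of 1 f2 y2 t] 2 by (auto simp: F_def qcomb_def)
  \<comment> \<open>Points mapped into the slice of \<open>y1, y2\<close> are closed under null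
    lines, so generic points suffice.\<close>
  have "u \<in> {u. \<exists>v. F u = qcomb y1 y2 v}" for u
  proof (rule null_line_closed_eq_UNIV)
    have "F 0 = qcomb y1 y2 0" by (simp add: F0 qcomb_zero)
    then show "0 \<in> {u. \<exists>v. F u = qcomb y1 y2 v}" by blast
  next
    fix P Q R assume PQ: "P \<in> {u. \<exists>v. F u = qcomb y1 y2 v}" "Q \<in> {u. \<exists>v. F u = qcomb y1 y2 v}"
      "P \<noteq> Q" "qf (P - Q) = 0" and RP: "qf (R - P) = 0" and RQ: "qf (R - Q) = 0"
    show "R \<in> {u. \<exists>v. F u = qcomb y1 y2 v}"
    proof (cases "R = P \<or> R = Q")
      case False
      obtain v w where v: "F P = qcomb y1 y2 v" and w: "F Q = qcomb y1 y2 w" using PQ by auto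
      have e: "F Q - F P = qcomb y1 y2 (w - v)" by (simp add: v w qcomb_diff)
      have PQ': "qf (Q - P) = 0" using PQ(4) by (metis minus_diff_eq qf_minus)
      have "F Q - F P \<noteq> 0" "rank_le1 (F Q - F P)" using Fadj[OF PQ'] PQ(3) by auto
      then have wv: "w - v \<noteq> 0" "qf (w - v) = 0" unfolding e using qcomb_rank_le1_imp_null[OF y12] by (auto simp: qcomb_zero)
      obtain t \<alpha> \<beta> where t: "t \<noteq> 0" "qcomb y1 y2 (w - v) = t *\<^sub>R sq (\<alpha> *\<^sub>R y1 + \<beta> *\<^sub>R y2)"
        "\<alpha> *\<^sub>R y1 + \<beta> *\<^sub>R y2 \<noteq> 0" by (rule qcomb_null_obtain[OF wv(2,1) y12])
      have "rank_le1 (F R - F P)" "rank_le1 (F R - F Q)" using Fadj[OF RP] Fadj[OF RQ] False by auto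
      moreover have "F R - F Q = (F R - F P) - t *\<^sub>R sq (\<alpha> *\<^sub>R y1 + \<beta> *\<^sub>R y2)"
        unfolding t(2)[symmetric] e[symmetric] by simp
      ultimately obtain s where s: "F R - F P = s *\<^sub>R sq (\<alpha> *\<^sub>R y1 + \<beta> *\<^sub>R y2)"
        using rank_le1_collinear[OF t(1,3), of "F R - F P"] by metis
      have s': "s *\<^sub>R sq (\<alpha> *\<^sub>R y1 + \<beta> *\<^sub>R y2) = qcomb y1 y2 ((s / t) *\<^sub>R (w - v))"
        unfolding qcomb_scaleR t(2) using t(1) by simp
      have "F R = F P + s *\<^sub>R sq (\<alpha> *\<^sub>R y1 + \<beta> *\<^sub>R y2)" unfolding s[symmetric] by simp
      then have "F R = qcomb y1 y2 (v + (s / t) *\<^sub>R (w - v))" unfolding qcomb_add v s' .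
      then show ?thesis by blast
    qed (use PQ in auto)
  next
    fix x b r :: real assume nz: "x \<noteq> 0" "b \<noteq> 0" "r \<noteq> 0" "x * r - b * b \<noteq> 0"
    define X where "X = (x, b, r)"
    \<comment> \<open>Parameters of the axis points at null distance from \<open>X\<close>.
      Subtracting the two resulting rank one conditions cancels \<open>F X\<close>, and
      \<open>sq_comb_in_span\<close> places \<open>u\<close> in the span of
      \<open>y1, y2\<close>.\<close>
    define d1 d2 where "d1 = (x * r - b * b) / r" and "d2 = (x * r - b * b) / x"
    have d: "d1 \<noteq> 0" "d2 \<noteq> 0" "d1 * r = x * r - b * b" "d2 * x = x * r - b * b"
      using nz by (auto simp: d1_def d2_def)
    have q: "qf (X - (d1, 0, 0)) = 0" "qf (X - (0, 0, d2)) = 0"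
      using d(3,4) by (simp_all add: X_def qf_def algebra_simps)
    obtain g1 where g1: "F (d1, 0, 0) = g1 *\<^sub>R sq y1" using ax1 by blast
    obtain g2 where g2: "F (0, 0, d2) = g2 *\<^sub>R sq y2" using ax2 by blast
    have g: "g1 \<noteq> 0" "g2 \<noteq> 0"
      using Fadj(1)[of "(d1, 0, 0)" 0] Fadj(1)[of "(0, 0, d2)" 0] d g1 g2 F0 by (auto simp: qf_def zero_prod_def)
    obtain s u where su: "F X - g1 *\<^sub>R sq y1 = s *\<^sub>R sq u"
      using Fadj(2)[OF q(1)] nz g1 by (auto simp: rank_le1_def X_def)
    obtain s' u' where su': "F X - g2 *\<^sub>R sq y2 = s' *\<^sub>R sq u'"
      using Fadj(2)[OF q(2)] nz g2 by (auto simp: rank_le1_def X_def)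
    have "s *\<^sub>R sq u + (- s') *\<^sub>R sq u' = (- g1) *\<^sub>R sq y1 + g2 *\<^sub>R sq y2"
      unfolding scaleR_minus_left su[symmetric] su'[symmetric] by simp
    then obtain \<alpha> \<beta> where ab: "u = \<alpha> *\<^sub>R y1 + \<beta> *\<^sub>R y2"
      using sq_comb_in_span[OF y12] g by (metis neg_equal_0_iff_equal)
    have "F X = g1 *\<^sub>R sq y1 + s *\<^sub>R sq u" unfolding su[symmetric] by simp
    also have "\<dots> = qcomb y1 y2 ((g1, 0, 0) + (s * (\<alpha> * \<alpha>), s * (\<alpha> * \<beta>), s * (\<beta> * \<beta>)))"
      unfolding qcomb_add qcomb_coords ab by (simp add: qcomb_def)
    finally show "(x, b, r) \<in> {u. \<exists>v. F u = qcomb y1 y2 v}" unfolding X_def by blast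
  qed
  then have ex: "\<forall>u. \<exists>v. F u = qcomb y1 y2 v" by blast
  from choice[OF ex] obtain \<Psi> where \<Psi>: "\<And>u. F u = qcomb y1 y2 (\<Psi> u)" by blast
  have diff: "F u - F v = qcomb y1 y2 (\<Psi> u - \<Psi> v)" for u v by (simp add: \<Psi> qcomb_diff)
  interpret nondeg_null_map \<Psi>
  proof
    fix x y :: r3 assume "qf (x - y) = 0" "x \<noteq> y"
    from Fadj[OF this] show "qf (\<Psi> x - \<Psi> y) = 0 \<and> \<Psi> x \<noteq> \<Psi> y"
      using qcomb_rank_le1_imp_null[OF y12] unfolding diff by (auto simp: \<Psi>)
  next
    fix z u v assume uv: "qf u = 0" "qf v = 0" "qb u v \<noteq> 0"
    have "u \<noteq> 0" "v \<noteq> 0"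
      using uv(3) qb_scaleR_left[of 0 0 v] qb_scaleR_right[of u 0 0] by auto
    obtain t \<alpha> \<beta> where t: "t \<noteq> 0" "qcomb p q u = t *\<^sub>R sq (\<alpha> *\<^sub>R p + \<beta> *\<^sub>R q)"
      "u = (t * (\<alpha> * \<alpha>), t * (\<alpha> * \<beta>), t * (\<beta> * \<beta>))"
      by (rule qcomb_null_obtain[OF uv(1) \<open>u \<noteq> 0\<close> n(4)])
    obtain s \<gamma> \<delta> where s: "s \<noteq> 0" "qcomb p q v = s *\<^sub>R sq (\<gamma> *\<^sub>R p + \<delta> *\<^sub>R q)"
      "v = (s * (\<gamma> * \<gamma>), s * (\<gamma> * \<delta>), s * (\<delta> * \<delta>))"
      by (rule qcomb_null_obtain[OF uv(2) \<open>v \<noteq> 0\<close> n(4)])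
    \<comment> \<open>Null vectors with \<open>qb u v\<close> nonzero thus belong to independent
      vectors of the slice, to which \<open>separated_move\<close> applies at the point
      \<open>z\<close>.\<close>
    have "qb u v = t * s * ((\<alpha> * \<delta> - \<beta> * \<gamma>) * (\<alpha> * \<delta> - \<beta> * \<gamma>))"
      unfolding t(3) s(3) by (simp add: qb_def algebra_simps)
    then have D: "\<alpha> * \<delta> - \<beta> * \<gamma> \<noteq> 0" using uv(3) by auto
    define A' p' q' where "A' = A + qcomb p q z" and "p' = \<alpha> *\<^sub>R p + \<beta> *\<^sub>R q" and "q' = \<gamma> *\<^sub>R p + \<delta> *\<^sub>R q"
    have N': "separated A' p' q'" unfolding A'_def p'_def q'_def by (rule separated_move[OF N D])
    have im: "\<Phi> (A' + qcomb p q w) = \<Phi> A' + qcomb y1 y2 (\<Psi> (z + w) - \<Psi> z)" for w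
      unfolding diff[symmetric] by (simp add: F_def A'_def qcomb_add add.assoc)
    define du dv where "du = \<Psi> (z + u) - \<Psi> z" and "dv = \<Psi> (z + v) - \<Psi> z"
    have nu: "F (z + u) \<noteq> F z" "rank_le1 (F (z + u) - F z)" "rank_le1 (F (z + v) - F z)"
      using Fadj[of "z + u" z] Fadj[of "z + v" z] uv \<open>u \<noteq> 0\<close> \<open>v \<noteq> 0\<close> by auto
    then have q: "qf du = 0" "qf dv = 0" "du \<noteq> 0"
      using qcomb_rank_le1_imp_null[OF y12] unfolding diff by (auto simp: du_def dv_def \<Psi>)
    show "qb (\<Psi> (z + u) - \<Psi> z) (\<Psi> (z + v) - \<Psi> z) \<noteq> 0"
    proof
      assume "qb (\<Psi> (z + u) - \<Psi> z) (\<Psi> (z + v) - \<Psi> z) = 0"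
      \<comment> \<open>Orthogonal null images would be parallel, making the two directions
        aligned.\<close>
      then obtain k where k: "dv = k *\<^sub>R du" using null_parallel[OF q(1,2) _ q(3)] by (auto simp: du_def dv_def)
      obtain r \<alpha>' \<beta>' where r: "qcomb y1 y2 du = r *\<^sub>R sq (\<alpha>' *\<^sub>R y1 + \<beta>' *\<^sub>R y2)"
        by (rule qcomb_null_obtain[OF q(1,3) y12])
      have i1: "\<Phi> (A' + t *\<^sub>R sq p') = \<Phi> A' + r *\<^sub>R sq (\<alpha>' *\<^sub>R y1 + \<beta>' *\<^sub>R y2)"
        using im[of u] unfolding t(2) du_def[symmetric] r p'_def .
      have i2: "\<Phi> (A' + s *\<^sub>R sq q') = \<Phi> A' + (k * r) *\<^sub>R sq (\<alpha>' *\<^sub>R y1 + \<beta>' *\<^sub>R y2)"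
        using im[of v] unfolding s(2) dv_def[symmetric] k qcomb_scaleR r q'_def by simp
      have "aligned A' p' q'"
        using line[OF _ _ t(1) i1, of 1] line[OF _ _ s(1) i2, of 1] N' unfolding aligned_def separated_def
        by (metis scaleR_one)
      then show False using N' by (simp add: separated_def)
    qed
  qed
  have "qcomb y1 y2 (\<Psi> (a *\<^sub>R e1 + c *\<^sub>R e2)) = qcomb y1 y2 (\<Psi> (c *\<^sub>R e2)) + a *\<^sub>R (qcomb y1 y2 (\<Psi> e1) - qcomb y1 y2 (\<Psi> 0))"
    using parallelogram[of 0 a c] by (simp add: qcomb_add qcomb_scaleR qcomb_diff)
  then have "F (a, 0, c) = F (0, 0, c) + a *\<^sub>R (F (1, 0, 0) - F 0)"
    by (simp add: \<Psi> e1_def e2_def)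
  then show ?thesis unfolding F0 by (simp add: F_def qcomb_def add.assoc)
qed

end

section \<open>From one separated slice to all slices\<close>

context adj_map
begin

lemma separated_linear_line:
  assumes "separated A p q"
  shows "\<Phi> (A + a *\<^sub>R sq p) = \<Phi> A + a *\<^sub>R (\<Phi> (A + sq p) - \<Phi> A)"
  using separated_additive[OF assms, of a 0] by simp

lemma separated_increment:
  assumes "separated A p q"
  shows "\<Phi> (A + c *\<^sub>R sq q + sq p) - \<Phi> (A + c *\<^sub>R sq q) = \<Phi> (A + sq p) - \<Phi> A"
  using separated_additive[OF assms, of 1 c] by (simp add: add.assoc add.commute add.left_commute)

text \<open>Writing \<open>sq (q + s *\<^sub>R p)\<close> as \<open>s *\<^sub>R sq (q + p) + (s * s
  - s) *\<^sub>R sq p + (1 - s) *\<^sub>R sq q\<close> gives a path along three lines of the slice,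
  on each of which the increments are known.\<close>

lemma separated_sq_comb:
  assumes N: "separated A p q"
  shows "\<exists>M. \<forall>s. \<Phi> (A + sq (q + s *\<^sub>R p)) = \<Phi> A + ((\<Phi> (A + sq q) - \<Phi> A) + s *\<^sub>R M + (s * s) *\<^sub>R (\<Phi> (A + sq p) - \<Phi> A))"
proof -
  define L where "L x = \<Phi> (A + sq x) - \<Phi> A" for x
  define M where "M = L (q + p) - L q - L p"
  have "\<Phi> (A + sq (q + s *\<^sub>R p)) = \<Phi> A + (L q + s *\<^sub>R M + (s * s) *\<^sub>R L p)" for s
  proof -
    have N1: "separated A (q + p) q" using separated_move[OF N, of 1 1 1 0 0] by (simp add: qcomb_zero add.commute)
    have N2: "separated A p (q + p)" using separated_move[OF N, of 1 1 0 1 0] by (simp add: qcomb_zero add.commute)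
    define A1 where "A1 = A + s *\<^sub>R sq (q + p)"
    have g: "s *\<^sub>R sq (q + p) = qcomb p q (s, s, s)"
      by (simp add: qcomb_def sq_def sprod_def fun_eq_iff algebra_simps)
    have N3: "separated A1 p q" unfolding A1_def g using separated_move[OF N, of 1 1 0 0] by simp
    have N4: "separated A1 q p" using separated_sym[OF N3] .
    have P1: "\<Phi> A1 = \<Phi> A + s *\<^sub>R L (q + p)" unfolding A1_def L_def by (rule separated_linear_line[OF N1])
    have I1: "\<Phi> (A1 + sq p) - \<Phi> A1 = L p" unfolding A1_def L_def by (rule separated_increment[OF N2])
    have N1': "separated A q (q + p)" by (rule separated_sym[OF N1])
    have I2: "\<Phi> (A1 + sq q) - \<Phi> A1 = L q" unfolding A1_def L_def by (rule separated_increment[OF N1'])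
    have "sq (q + s *\<^sub>R p) = s *\<^sub>R sq (q + p) + (s * s - s) *\<^sub>R sq p + (1 - s) *\<^sub>R sq q"
      by (simp add: sq_def fun_eq_iff algebra_simps)
    then have "\<Phi> (A + sq (q + s *\<^sub>R p)) = \<Phi> (A1 + (s * s - s) *\<^sub>R sq p + (1 - s) *\<^sub>R sq q)"
      by (simp add: A1_def add.assoc)
    also have "\<dots> = \<Phi> (A1 + (1 - s) *\<^sub>R sq q) + (s * s - s) *\<^sub>R L p"
      by (simp only: separated_additive[OF N3] I1)
    also have "\<dots> = \<Phi> A1 + (1 - s) *\<^sub>R L q + (s * s - s) *\<^sub>R L p"
      by (simp only: separated_linear_line[OF N4] I2)
    also have "\<dots> = \<Phi> A + (L q + s *\<^sub>R M + (s * s) *\<^sub>R L p)"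
      unfolding P1 M_def by (simp add: fun_eq_iff algebra_simps)
    finally show ?thesis .
  qed
  then show ?thesis unfolding L_def by blast
qed

text \<open>All points of this quadratic pencil are rank one away from \<open>\<Phi> A\<close>, so
  the mixed term is a multiple of \<open>sprod y y'\<close>. The relation
  \<open>\<beta> * \<beta> = h * f\<close> also gives \<open>h\<close> and \<open>f\<close> the same
  sign.\<close>

lemma separated_pencil:
  assumes N: "separated A p q" and p: "\<Phi> (A + sq p) = \<Phi> A + f *\<^sub>R sq y" and q: "\<Phi> (A + sq q) = \<Phi> A + h *\<^sub>R sq y'"
  obtains \<beta> where "\<beta> * \<beta> = h * f" "h \<noteq> 0" "f \<noteq> 0" "nonpar y y'"
    "\<forall>s. \<Phi> (A + sq (q + s *\<^sub>R p)) = \<Phi> A + (h *\<^sub>R sq y' + (s * \<beta>) *\<^sub>R sprod y y' + (s * s * f) *\<^sub>R sq y)"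
proof -
  have n: "A \<in> S" "p \<in> U" "q \<in> U" "nonpar p q" "\<not> aligned A p q" using N by (auto simp: separated_def)
  have nz: "f *\<^sub>R sq y \<noteq> 0" "h *\<^sub>R sq y' \<noteq> 0"
    using adj[of A p 1] adj[of A q 1] n nonpar_nz[OF n(4)] p q by auto
  then have fh: "f \<noteq> 0" "h \<noteq> 0" "y \<noteq> 0" by (auto simp: sq_zero)
  have iy: "nonpar y y'"
  proof (rule ccontr)
    assume "\<not> nonpar y y'"
    then obtain k where "y' = k *\<^sub>R y" using not_nonpar fh by metis
    then have "\<Phi> (A + sq q) = \<Phi> A + (h * (k * k)) *\<^sub>R sq y" using q by (simp add: sq_scaleR)
    then show False using n(5) p unfolding aligned_def by blast
  qed
  obtain M where M: "\<And>s. \<Phi> (A + sq (q + s *\<^sub>R p)) = \<Phi> A + (h *\<^sub>R sq y' + s *\<^sub>R M + (s * s) *\<^sub>R (f *\<^sub>R sq y))"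
    using separated_sq_comb[OF N] unfolding p q by auto
  have "rank_le1 (h *\<^sub>R sq y' + s *\<^sub>R M + (s * s) *\<^sub>R (f *\<^sub>R sq y))" for s
  proof -
    have "q + s *\<^sub>R p \<in> U" using U_comb[OF n(3,2), of 1 s] by simp
    moreover have "q + s *\<^sub>R p \<noteq> 0"
    proof
      assume "q + s *\<^sub>R p = 0"
      then have "q = (- s) *\<^sub>R p" by (simp add: eq_neg_iff_add_eq_0)
      then show False using n(4) by (simp add: nonpar_def)
    qed
    ultimately have "rank_le1 (\<Phi> (A + sq (q + s *\<^sub>R p)) - \<Phi> A)" using adj[OF n(1), of "q + s *\<^sub>R p" 1] by simp
    then show ?thesis unfolding M by simp
  qed
  then obtain \<beta> where "M = \<beta> *\<^sub>R sprod y y'" "\<beta> * \<beta> = h * f"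
    using quadratic_pencil_rank_le1[OF iy fh(2,1)] by blast
  then show ?thesis using that[of \<beta>] fh iy M by simp
qed

text \<open>If \<open>z\<close> had the image direction of \<open>x\<close>, then suitable \<open>x' + s x\<close> and \<open>x' + t z\<close> would have the same
  image, and collapsing their slice would also merge the directions of \<open>x\<close> and \<open>x' + s x\<close>.\<close>

lemma separated_exchange:
  assumes N: "separated A x x'" and z: "z \<in> U" "nonpar x z"
  shows "separated A x z"
proof (rule ccontr)
  assume nN: "\<not> separated A x z"
  have n: "A \<in> S" "x \<in> U" "x' \<in> U" "nonpar x x'" "\<not> aligned A x x'" using N by (auto simp: separated_def)
  have nz: "x \<noteq> 0" "x' \<noteq> 0" "z \<noteq> 0" using n z nonpar_nz by auto
  have Cxz: "aligned A x z" using nN n z by (auto simp: separated_def)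
  \<comment> \<open>Inside the slice of \<open>x, x'\<close> the claim is
    \<open>separated_move\<close>; so \<open>z\<close> lies outside.\<close>
  have notspan: "z \<noteq> a *\<^sub>R x + b *\<^sub>R x'" for a b
  proof
    assume e: "z = a *\<^sub>R x + b *\<^sub>R x'"
    then have "b \<noteq> 0" using z(2) nonpar_comb'[OF n(4)] by simp
    then show False using separated_move[OF N, of 1 b 0 a 0] nN by (simp add: e qcomb_zero)
  qed
  have ix': "nonpar z x'"
  proof (rule ccontr)
    assume "\<not> nonpar z x'"
    then obtain c where "z = c *\<^sub>R x'" using not_nonpar[of x' z] nz by (metis nonpar_commute)
    then show False using notspan[of 0 c] by simp
  qed
  have "\<not> aligned A z x'" using aligned_trans[OF Cxz _ nz(3) n(1) z(1)] n(5) by blast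
  then have Nz: "separated A z x'" using n z ix' by (simp add: separated_def)
  obtain y f g where y: "\<Phi> (A + sq x) = \<Phi> A + f *\<^sub>R sq y" "\<Phi> (A + sq z) = \<Phi> A + g *\<^sub>R sq y"
    using Cxz by (auto simp: aligned_def)
  obtain h y' where y': "\<Phi> (A + sq x') = \<Phi> A + h *\<^sub>R sq y'" using direction n nz by metis
  obtain b where b: "b * b = h * f" "h \<noteq> 0" "f \<noteq> 0" "nonpar y y'"
    "\<forall>s. \<Phi> (A + sq (x' + s *\<^sub>R x)) = \<Phi> A + (h *\<^sub>R sq y' + (s * b) *\<^sub>R sprod y y' + (s * s * f) *\<^sub>R sq y)"
    by (rule separated_pencil[OF N y(1) y'])
  obtain b' where b': "b' * b' = h * g" "h \<noteq> 0" "g \<noteq> 0" "nonpar y y'"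
    "\<forall>s. \<Phi> (A + sq (x' + s *\<^sub>R z)) = \<Phi> A + (h *\<^sub>R sq y' + (s * b') *\<^sub>R sprod y y' + (s * s * g) *\<^sub>R sq y)"
    by (rule separated_pencil[OF Nz y(2) y'])
  have b0: "b \<noteq> 0" "b' \<noteq> 0" using b(1,2,3) b'(1,3) by auto
  \<comment> \<open>With these parameters both pencils have mixed coefficient 1 and quadratic
    coefficient \<open>1 / h\<close>, so the images coincide.\<close>
  define u w where "u = x' + (1 / b) *\<^sub>R x" and "w = x' + (1 / b') *\<^sub>R z"
  have c: "1 / b * (1 / b) * f = 1 / h" "1 / b' * (1 / b') * g = 1 / h"
    using b b' b0 by (simp_all add: field_simps)
  have eq: "\<Phi> (A + sq u) = \<Phi> (A + sq w)"
    using b(5)[rule_format, of "1 / b"] b'(5)[rule_format, of "1 / b'"] b0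
    unfolding u_def w_def c by simp
  have uw: "u \<in> U" "w \<in> U"
    using U_comb[OF n(3,2), of 1 "1 / b"] U_comb[OF n(3) z(1), of 1 "1 / b'"] by (simp_all add: u_def w_def)
  have iux: "nonpar x u" using nonpar_comb'[OF n(4), of "1 / b" 1] by (simp add: u_def add.commute)
  then have u0: "u \<noteq> 0" using nonpar_nz by blast
  have iuw: "nonpar u w"
  proof (rule ccontr)
    assume "\<not> nonpar u w"
    then obtain k where k: "w = k *\<^sub>R u" using not_nonpar u0 by blast
    have "(1 / b') *\<^sub>R z = w - x'" by (simp add: w_def)
    also have "\<dots> = (k / b) *\<^sub>R x + (k - 1) *\<^sub>R x'" unfolding k u_def by (simp add: fun_eq_iff algebra_simps)
    finally have "b' *\<^sub>R ((1 / b') *\<^sub>R z) = b' *\<^sub>R ((k / b) *\<^sub>R x + (k - 1) *\<^sub>R x')" by simp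
    then have "z = (b' * (k / b)) *\<^sub>R x + (b' * (k - 1)) *\<^sub>R x'" using b0 by (simp add: scaleR_add_right)
    then show False using notspan by blast
  qed
  obtain y0 f0 where y0: "\<Phi> (A + sq u) = \<Phi> A + f0 *\<^sub>R sq y0" "f0 \<noteq> 0" "y0 \<noteq> 0"
    by (rule direction[OF n(1) uw(1) u0])
  \<comment> \<open>This vector lies in the span of \<open>u, w\<close> and in that of
    \<open>x, z\<close>. Both slices collapse, so \<open>v\<close> transfers alignment from
    \<open>u\<close> to \<open>x\<close>.\<close>
  define v where "v = u - w"
  have v: "v = (1 / b) *\<^sub>R x + (- 1 / b') *\<^sub>R z" by (simp add: v_def u_def w_def)
  have vU: "v \<in> U" unfolding v by (rule U_comb[OF n(2) z(1)])
  have "nonpar x v" unfolding v using nonpar_comb'[OF z(2), of "1 / b" "- 1 / b'"] b0 by simp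
  then have v0: "v \<noteq> 0" by (rule nonpar_nz(2))
  have sv: "sq v = qcomb u w (1, - 1, 1)"
    by (simp add: v_def qcomb_def sq_def sprod_def fun_eq_iff algebra_simps)
  obtain r where "\<Phi> (A + sq v) = \<Phi> A + r *\<^sub>R sq y0"
    unfolding sv using collapse_qcomb[OF n(1) uw iuw y0(1)] y0(1) eq by metis
  then have Cuv: "aligned A u v" using y0(1) unfolding aligned_def by blast
  have sv': "sq v = qcomb x z (1 / b * (1 / b), - (1 / b * (1 / b')), 1 / b' * (1 / b'))"
    unfolding v by (simp add: qcomb_def sq_def sprod_def fun_eq_iff algebra_simps)
  obtain r' where "\<Phi> (A + sq v) = \<Phi> A + r' *\<^sub>R sq y"
    unfolding sv' using collapse_qcomb[OF n(1,2) z y] by metis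
  then have Cvx: "aligned A v x" using y(1) unfolding aligned_def by blast
  have "aligned A u x" using aligned_trans[OF Cuv Cvx v0 n(1) vU] .
  moreover have "separated A x u" using separated_move[OF N, of 1 1 0 "1 / b" 0] by (simp add: qcomb_zero u_def add.commute)
  ultimately show False using aligned_sym by (simp add: separated_def)
qed

text \<open>First \<open>x\<close> is exchanged for \<open>p\<close>, unless the two are parallel
  and rescaling suffices; a second exchange brings in \<open>q\<close>.\<close>

lemma separated_all_pairs:
  assumes N: "separated A x x'" and "p \<in> U" "q \<in> U" "nonpar p q"
  shows "separated A p q"
proof -
  have n: "A \<in> S" "x \<in> U" "x' \<in> U" "nonpar x x'" using N by (auto simp: separated_def)
  have "\<exists>r. separated A p r"
  proof (cases "nonpar x p")
    case True
    then show ?thesis using separated_sym[OF separated_exchange[OF N assms(2)]] by blast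
  next
    case False
    then obtain c where c: "p = c *\<^sub>R x" using not_nonpar nonpar_nz n by metis
    then have "c \<noteq> 0" using nonpar_nz(1)[OF assms(4)] by auto
    then show ?thesis using separated_move[OF N, of c 1 0 0 0] by (auto simp: qcomb_zero c)
  qed
  then show ?thesis using separated_exchange assms by blast
qed

text \<open>Each rank one step from \<open>A\<close> along \<open>z\<close> stays in a slice
  containing \<open>z\<close>, so \<open>separated_move\<close> carries separation to the new point
  and \<open>separated_all_pairs\<close> spreads it there.\<close>

lemma separated_everywhere:
  assumes N: "separated A x x'" and "B \<in> S" "p \<in> U" "q \<in> U" "nonpar p q"
  shows "separated B p q"
proof -
  have n: "A \<in> S" "x \<in> U" "x' \<in> U" "nonpar x x'" using N by (auto simp: separated_def)
  have "\<forall>p q. p \<in> U \<longrightarrow> q \<in> U \<longrightarrow> nonpar p q \<longrightarrow> separated (A + M) p q" if "M \<in> S" for M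
    using that
  proof (induction rule: span_induct_alt)
    case base
    then show ?case using separated_all_pairs[OF N] by simp
  next
    case (step c Z M)
    then obtain z where z: "Z = sq z" "z \<in> U" by auto
    have N0: "separated (A + M) x x'" using step n by blast
    show ?case
    proof (cases "z = 0")
      case True
      then show ?thesis using step by (simp add: z sq_zero)
    next
      case False
      have "\<exists>w. w \<in> U \<and> nonpar z w"
      proof (cases "nonpar z x")
        case False
        then obtain k where k: "x = k *\<^sub>R z" using not_nonpar \<open>z \<noteq> 0\<close> by blast
        have "nonpar z x'" using n(4) unfolding k nonpar_def by auto
        then show ?thesis using n by blast
      qed (use n in blast)
      then obtain w where w: "w \<in> U" "nonpar z w" by blast
      then have "separated (A + M) z w" using step z by blast
      from separated_move[OF this, of 1 1 0 0 "(c, 0, 0)"] have "separated (c *\<^sub>R Z + M + A) z w"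
        by (simp add: qcomb_def z add.commute add.left_commute add.assoc)
      then show ?thesis using separated_all_pairs by (metis add.commute)
    qed
  qed
  from this[of "B - A"] show ?thesis using assms n by (simp add: span_diff)
qed

section \<open>The global form of the map in the two cases\<close>

text \<open>The induction carries more than the claim: at each point reached, the images of all
  lines through it have direction \<open>y\<close>.\<close>

lemma degenerate:
  assumes aligned: "\<And>A p q. A \<in> S \<Longrightarrow> p \<in> U \<Longrightarrow> q \<in> U \<Longrightarrow> nonpar p q \<Longrightarrow> aligned A p q"
    and x0: "x0 \<in> U" "x0 \<noteq> 0" and y: "\<Phi> (sq x0) = \<Phi> 0 + f *\<^sub>R sq y"
    and "A \<in> S"
  shows "\<exists>t. \<Phi> A = \<Phi> 0 + t *\<^sub>R sq y"
proof -
  have dir: "\<exists>t. \<Phi> (A + sq x) = \<Phi> A + t *\<^sub>R sq y"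
    if "A \<in> S" "z \<in> U" and z0: "z \<noteq> 0" and "\<Phi> (A + sq z) = \<Phi> A + s *\<^sub>R sq y" "x \<in> U" for A x z s
  proof (cases "nonpar z x")
    case True
    then show ?thesis using aligned_line[OF aligned] that by blast
  next
    case False
    then obtain k where "x = k *\<^sub>R z" by (rule not_nonpar[OF _ z0])
    then show ?thesis using line[of A z 1 s y "k * k"] that by (simp add: sq_scaleR)
  qed
  have "(\<exists>t. \<Phi> A = \<Phi> 0 + t *\<^sub>R sq y) \<and> A \<in> S \<and> (\<forall>x\<in>U. \<exists>t. \<Phi> (A + sq x) = \<Phi> A + t *\<^sub>R sq y)"
    using assms(5)
  proof (induction rule: span_induct_alt)
    case base
    have "\<exists>t. \<Phi> (0 + sq x) = \<Phi> 0 + t *\<^sub>R sq y" if "x \<in> U" for x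
      by (rule dir[OF _ x0]) (use y that in \<open>auto simp: span_zero\<close>)
    moreover have "\<exists>t. \<Phi> 0 = \<Phi> 0 + t *\<^sub>R sq y" by (rule exI[of _ 0]) simp
    ultimately show ?case using span_zero by blast
  next
    case (step c Z A)
    then obtain z where z: "Z = sq z" "z \<in> U" by auto
    obtain t0 where t0: "\<Phi> A = \<Phi> 0 + t0 *\<^sub>R sq y" using step by blast
    define A1 where "A1 = A + c *\<^sub>R sq z"
    have e: "c *\<^sub>R Z + A = A1" by (simp add: A1_def z)
    have A1S: "A1 \<in> S" unfolding A1_def using step z by (simp add: span_add S_sq)
    show ?case
    proof (cases "c = 0 \<or> z = 0")
      case True
      then have "A1 = A" by (auto simp: A1_def sq_zero)
      then show ?thesis unfolding e using step by simp
    next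
      case False
      obtain t where "\<Phi> (A + sq z) = \<Phi> A + t *\<^sub>R sq y" using step z by blast
      then obtain r where r: "\<Phi> A1 = \<Phi> A + r *\<^sub>R sq y"
        using line[of A z 1 t y c] step z by (auto simp: A1_def)
      \<comment> \<open>The way back from \<open>A1\<close> to \<open>A\<close> shows that direction
        \<open>z\<close> at \<open>A1\<close> still maps to direction \<open>y\<close>; alignment
        passes this on to all directions.\<close>
      have "\<Phi> (A1 + (- c) *\<^sub>R sq z) = \<Phi> A1 + (- r) *\<^sub>R sq y" by (simp add: r) (simp add: A1_def)
      then obtain s where "\<Phi> (A1 + sq z) = \<Phi> A1 + s *\<^sub>R sq y"
        using line[of A1 z "- c" "- r" y 1] A1S z False by auto
      then have "\<forall>x\<in>U. \<exists>t. \<Phi> (A1 + sq x) = \<Phi> A1 + t *\<^sub>R sq y" using dir[OF A1S] z False by blast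
      moreover have "\<Phi> A1 = \<Phi> 0 + (t0 + r) *\<^sub>R sq y" by (simp add: r t0 scaleR_add_left add.assoc)
      ultimately show ?thesis unfolding e using A1S by blast
    qed
  qed
  then show ?thesis by blast
qed

text \<open>Every pair is separated everywhere, so the increment along \<open>sq p\<close> does not
  change when the base point moves along any \<open>sq q\<close>. It is therefore the same at all
  points of \<open>S\<close>.\<close>

lemma nondegenerate_linear:
  assumes N: "separated A0 x x'" and z: "\<Phi> 0 = 0" and "A \<in> S" "B \<in> S"
  shows "\<Phi> (A + B) = \<Phi> A + \<Phi> B" and "\<Phi> (a *\<^sub>R B) = a *\<^sub>R \<Phi> B"
proof -
  have n: "x \<in> U" "x' \<in> U" "nonpar x x'" using N by (auto simp: separated_def)
  have NN: "separated A p q" if "A \<in> S" "p \<in> U" "q \<in> U" "nonpar p q" for A p q using separated_everywhere[OF N that] .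
  have ex: "\<exists>w. w \<in> U \<and> nonpar p w" if p0: "p \<noteq> 0" for p
  proof (cases "nonpar p x")
    case False
    then obtain k where k: "x = k *\<^sub>R p" by (rule not_nonpar[OF _ p0])
    have "nonpar p x'" using n(3) unfolding k nonpar_def by auto
    then show ?thesis using n by blast
  qed (use n in blast)
  have lin: "\<Phi> (A + a *\<^sub>R sq p) = \<Phi> A + a *\<^sub>R (\<Phi> (A + sq p) - \<Phi> A)" if "A \<in> S" "p \<in> U" for A a p
  proof (cases "p = 0")
    case False
    then obtain w where "w \<in> U" "nonpar p w" using ex by blast
    then show ?thesis using separated_linear_line NN that by blast
  qed (simp add: sq_zero)
  have inc1: "\<Phi> (A + c *\<^sub>R sq q + sq p) - \<Phi> (A + c *\<^sub>R sq q) = \<Phi> (A + sq p) - \<Phi> A"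
    if "A \<in> S" "p \<in> U" "q \<in> U" for A c p q
  proof (cases "p = 0 \<or> nonpar p q")
    case True
    then show ?thesis using separated_increment NN that by (auto simp: sq_zero)
  next
    case False
    \<comment> \<open>For \<open>q\<close> parallel to \<open>p\<close> there is no slice; both
      moves stay on one line, where \<open>lin\<close> applies.\<close>
    then obtain k where k: "q = k *\<^sub>R p" using not_nonpar by blast
    define L where "L = \<Phi> (A + sq p) - \<Phi> A"
    have 1: "A + c *\<^sub>R sq q = A + (c * (k * k)) *\<^sub>R sq p"
      "A + c *\<^sub>R sq q + sq p = A + (c * (k * k) + 1) *\<^sub>R sq p"
      by (simp_all add: k sq_scaleR scaleR_add_left add.assoc)
    have "\<Phi> (A + c *\<^sub>R sq q) = \<Phi> A + (c * (k * k)) *\<^sub>R L"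
      unfolding 1(1) L_def by (rule lin[OF that(1,2)])
    moreover have "\<Phi> (A + c *\<^sub>R sq q + sq p) = \<Phi> A + (c * (k * k) + 1) *\<^sub>R L"
      unfolding 1(2) L_def by (rule lin[OF that(1,2)])
    ultimately show ?thesis by (simp add: L_def scaleR_add_left)
  qed
  have inc: "\<Phi> (A + sq p) - \<Phi> A = \<Phi> (sq p)" if "A \<in> S" "p \<in> U" for A p
  proof -
    have "A \<in> S \<and> \<Phi> (A + sq p) - \<Phi> A = \<Phi> (sq p)" using that(1)
    proof (induction rule: span_induct_alt)
      case (step c Z A)
      then obtain w where w: "Z = sq w" "w \<in> U" by auto
      have e: "c *\<^sub>R Z + A = A + c *\<^sub>R sq w" by (simp add: w add.commute)
      have "A + c *\<^sub>R sq w \<in> S" using step w by (simp add: span_add S_sq)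
      then show ?case unfolding e using inc1[of A p w c] step w that(2) by metis
    qed (simp only: z span_zero add_0_left diff_zero simp_thms)
    then show ?thesis by simp
  qed
  have lin0: "\<Phi> (A + c *\<^sub>R sq w) = \<Phi> A + c *\<^sub>R \<Phi> (sq w)" if "A \<in> S" "w \<in> U" for A c w
    by (simp only: lin[OF that] inc[OF that])
  have "\<forall>A\<in>S. \<Phi> (A + B) = \<Phi> A + \<Phi> B" if "B \<in> S" for B using that
  proof (induction rule: span_induct_alt)
    case (step c Z B)
    then obtain w where w: "Z = sq w" "w \<in> U" by auto
    have st: "\<Phi> (A + (c *\<^sub>R Z + B)) = \<Phi> A + c *\<^sub>R \<Phi> (sq w) + \<Phi> B" if "A \<in> S" for A
    proof -
      have "\<Phi> (A + c *\<^sub>R sq w + B) = \<Phi> (A + c *\<^sub>R sq w) + \<Phi> B"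
        by (rule bspec[OF step(2) span_add[OF that S_sq[OF w(2)]]])
      then show ?thesis using lin0[OF that w(2), of c] by (simp add: w add.assoc)
    qed
    note st0 = st[OF span_zero, unfolded z add_0_left]
    show ?case
    proof (rule ballI)
      fix A assume "A \<in> S"
      from st[OF this] show "\<Phi> (A + (c *\<^sub>R Z + B)) = \<Phi> A + \<Phi> (c *\<^sub>R Z + B)"
        unfolding st0 by (simp only: add.assoc)
    qed
  qed (intro ballI, simp only: z add_0_right)
  then have add: "\<Phi> (A + B) = \<Phi> A + \<Phi> B" if "A \<in> S" "B \<in> S" for A B
    using that by blast
  show "\<Phi> (A + B) = \<Phi> A + \<Phi> B" by (rule add[OF assms(3,4)])
  have "B \<in> S \<and> \<Phi> (a *\<^sub>R B) = a *\<^sub>R \<Phi> B" using assms(4)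
  proof (induction rule: span_induct_alt)
    case base
    show ?case by (simp only: z scaleR_zero_right span_zero simp_thms)
  next
    case (step c Z B)
    then obtain w where w: "Z = sq w" "w \<in> U" by auto
    have B: "B \<in> S" "\<Phi> (a *\<^sub>R B) = a *\<^sub>R \<Phi> B" using step by blast+
    have sc: "\<Phi> (c *\<^sub>R sq w) = c *\<^sub>R \<Phi> (sq w)" for c
      using lin0[OF span_zero w(2), of c] unfolding z add_0_left .
    have "\<Phi> (a *\<^sub>R (c *\<^sub>R Z + B)) = \<Phi> ((a * c) *\<^sub>R sq w + a *\<^sub>R B)" by (simp only: w scaleR_add_right scaleR_scaleR)
    also have "\<dots> = (a * c) *\<^sub>R \<Phi> (sq w) + a *\<^sub>R \<Phi> B"
      by (simp only: add[OF S_sq[OF w(2)] span_scale[OF B(1)]] sc B(2))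
    also have "\<dots> = a *\<^sub>R \<Phi> (c *\<^sub>R Z + B)"
      by (simp only: w add[OF S_sq[OF w(2)] B(1)] sc scaleR_add_right scaleR_scaleR)
    finally have "\<Phi> (a *\<^sub>R (c *\<^sub>R Z + B)) = a *\<^sub>R \<Phi> (c *\<^sub>R Z + B)" .
    moreover have "c *\<^sub>R Z + B \<in> S" using B(1) w by (simp add: span_add S_sq)
    ultimately show ?case by blast
  qed
  then show "\<Phi> (a *\<^sub>R B) = a *\<^sub>R \<Phi> B" by blast
qed

text \<open>Square roots of the images of \<open>sq x\<close> are ambiguous in sign, so
  \<open>T\<close> is read off linearly from the mixed terms with a fixed vector \<open>x0\<close>.
  The sign \<open>c\<close> of the image of \<open>sq x0\<close> is shared by all others through
  \<open>separated_pencil\<close>.\<close>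

lemma nondegenerate_square_root:
  assumes N: "separated A0 x0 x1" and z: "\<Phi> 0 = 0"
  obtains c T where "c \<in> {- 1, 1 :: real}"
    "\<forall>p\<in>U. \<forall>q\<in>U. T (p + q) = T p + T q" "\<forall>p\<in>U. \<forall>a. T (a *\<^sub>R p) = a *\<^sub>R T p"
    "\<forall>x\<in>U. x \<noteq> 0 \<longrightarrow> T x \<noteq> 0" "\<forall>x\<in>U. \<Phi> (sq x) = c *\<^sub>R sq (T x)"
proof -
  have x0: "x0 \<in> U" "x0 \<noteq> 0" using N nonpar_nz by (auto simp: separated_def)
  note add = nondegenerate_linear(1)[OF N z] and scale = nondegenerate_linear(2)[OF N z span_zero]
  have sprod_S: "sprod p q \<in> S" if "p \<in> U" "q \<in> U" for p q
    using S_qcomb[OF that, of "(0, 1, 0)"] by (simp add: qcomb_def)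
  obtain f y where fy: "\<Phi> (0 + sq x0) = \<Phi> 0 + f *\<^sub>R sq y" "f \<noteq> 0" "y \<noteq> 0"
    by (rule direction[OF span_zero x0])
  \<comment> \<open>The modulus of \<open>f\<close> is absorbed into \<open>y1\<close>, leaving only
    the sign.\<close>
  define c where "c = sgn f"
  define y1 where "y1 = sqrt \<bar>f\<bar> *\<^sub>R y"
  have c: "c \<in> {- 1, 1}" "c * c = 1" using fy(2) by (auto simp: c_def sgn_if)
  have "f = c * \<bar>f\<bar>" by (simp add: c_def sgn_mult_abs)
  then have y1: "\<Phi> (sq x0) = c *\<^sub>R sq y1" using fy(1) unfolding z y1_def sq_scaleR by simp
  obtain i where "y i \<noteq> 0" using fy(3) by (auto simp: fun_eq_iff)
  then have i: "y1 i \<noteq> 0" using fy(2) by (simp add: y1_def)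
  \<comment> \<open>\<open>y y1\<^sup>T + y1 y\<^sup>T\<close> determines \<open>y\<close> linearly once \<open>y1\<close> is known; applied to
    \<open>\<Phi> (x x0\<^sup>T + x0 x\<^sup>T)\<close> this removes the sign ambiguity of a square root of \<open>\<Phi> (x x\<^sup>T)\<close>\<close>
  define rt where "rt M = (\<lambda>j. M j i / y1 i - M i i / (2 * (y1 i * y1 i)) * y1 j)" for M :: "'j \<Rightarrow> 'j \<Rightarrow> real"
  have rt_add: "rt (M + M') = rt M + rt M'" and rt_scale: "rt (a *\<^sub>R M) = a *\<^sub>R rt M" for M M' a
    by (simp_all add: rt_def fun_eq_iff add_divide_distrib right_diff_distrib distrib_right)
  have rt_sprod: "rt (sprod y1 w) = w" for w
    using i by (simp add: rt_def sprod_def fun_eq_iff field_simps)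
  define T where "T x = c *\<^sub>R rt (\<Phi> (sprod x x0))" for x
  have T_add: "T (p + q) = T p + T q" if "p \<in> U" "q \<in> U" for p q
    unfolding T_def sprod_add_left add[OF sprod_S[OF that(1) x0(1)] sprod_S[OF that(2) x0(1)]] rt_add
    by (rule scaleR_add_right)
  have T_scale: "T (a *\<^sub>R p) = a *\<^sub>R T p" if "p \<in> U" for a p
    unfolding T_def sprod_scaleR_left scale[OF sprod_S[OF that x0(1)]] rt_scale by (simp add: mult.commute)
  have sq: "\<Phi> (sq x) = c *\<^sub>R sq (T x)" if xU: "x \<in> U" for x
  proof (cases "nonpar x0 x")
    case True
    have NN: "separated 0 x0 x" by (rule separated_everywhere[OF N span_zero x0(1) xU True])
    obtain h y' where y': "\<Phi> (0 + sq x) = \<Phi> 0 + h *\<^sub>R sq y'"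
      using direction[OF span_zero xU nonpar_nz(2)[OF True]] by metis
    have p0: "\<Phi> (0 + sq x0) = \<Phi> 0 + c *\<^sub>R sq y1" using y1 by (simp only: z add_0_left)
    obtain b where b: "b * b = h * c" "h \<noteq> 0" "c \<noteq> 0" "nonpar y1 y'"
      "\<forall>s. \<Phi> (0 + sq (x + s *\<^sub>R x0)) = \<Phi> 0 + (h *\<^sub>R sq y' + (s * b) *\<^sub>R sprod y1 y' + (s * s * c) *\<^sub>R sq y1)"
      by (rule separated_pencil[OF NN p0 y'])
    have "\<Phi> (sq x + sprod x x0 + sq x0) = h *\<^sub>R sq y' + b *\<^sub>R sprod y1 y' + c *\<^sub>R sq y1"
      using b(5)[rule_format, of 1] by (simp only: z add_0_left scaleR_one mult_1 sq_add)
    moreover have "\<Phi> (sq x + sprod x x0 + sq x0) = \<Phi> (sq x) + \<Phi> (sprod x x0) + \<Phi> (sq x0)"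
    proof -
      have "sq x \<in> S" "sq x0 \<in> S" using S_sq[OF xU, of 1] S_sq[OF x0(1), of 1] by simp_all
      then show ?thesis using sprod_S[OF xU x0(1)] by (simp only: add span_add)
    qed
    moreover have h: "\<Phi> (sq x) = h *\<^sub>R sq y'" using y' by (simp only: z add_0_left)
    ultimately have "\<Phi> (sprod x x0) = b *\<^sub>R sprod y1 y'" unfolding y1 by simp
    then have "T x = (c * b) *\<^sub>R y'" unfolding T_def by (simp only: rt_scale rt_sprod scaleR_scaleR)
    \<comment> \<open>Squaring removes the sign of \<open>b\<close>, and
      \<open>b * b = h * c\<close> with \<open>c * c = 1\<close> reduces the coefficient to
      \<open>h\<close>.\<close>
    then have "c *\<^sub>R sq (T x) = (c * c * (c * (b * b))) *\<^sub>R sq y'" by (simp add: sq_scaleR mult.commute mult.left_commute)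
    also have "c * c * (c * (b * b)) = h" using c(2) b(1) by (simp add: mult.commute mult.left_commute)
    finally have "c *\<^sub>R sq (T x) = h *\<^sub>R sq y'" .
    then show ?thesis unfolding h by (rule sym)
  next
    case False
    then obtain k where k: "x = k *\<^sub>R x0" by (rule not_nonpar[OF _ x0(2)])
    have S0: "sq x0 \<in> S" using S_sq[OF x0(1), of 1] by simp
    have "\<Phi> (sprod x0 x0) = c *\<^sub>R sprod y1 y1"
      unfolding sprod_self scale[OF S0] y1 by (simp add: mult.commute)
    then have "T x0 = y1" unfolding T_def by (simp only: rt_scale rt_sprod scaleR_scaleR c(2) scaleR_one)
    then have "T x = k *\<^sub>R y1" unfolding k T_scale[OF x0(1)] by simp
    then show ?thesis unfolding k sq_scaleR scale[OF S0] y1 by (simp add: sq_scaleR mult.commute)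
  qed
  have inj: "T x \<noteq> 0" if "x \<in> U" "x \<noteq> 0" for x
  proof
    assume "T x = 0"
    then have "\<Phi> (sq x) = 0" using sq[OF that(1)] by (simp add: sq_zero)
    then show False using adj[OF span_zero that, of 1] z by simp
  qed
  show ?thesis using that[of c T] c(1) T_add T_scale inj sq by blast
qed

end

section \<open>Passing to matrices with carriers\<close>

text \<open>A maximal independent set of columns is a single vector \<open>v\<close>, so all columns
  are multiples of \<open>v\<close>.\<close>

lemma (in vec_space) rank_1_product_entries:
  assumes A: "A \<in> carrier_mat n nc" and rk: "rank A = 1"
  obtains f g where "\<forall>i<n. \<forall>j<nc. A $$ (i, j) = f i * g j"
proof -
  have cc: "set (cols A) \<subseteq> carrier_vec n" using cols_dim A by blast
  have li: "lin_indpt {}" by (rule finite_lin_indpt2) auto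
  have "\<exists>S. finite S \<and> maximal S (\<lambda>T. T \<subseteq> set (cols A) \<and> lin_indpt T) \<and> {} \<subseteq> S"
    by (rule maximal_exists_superset[of "set (cols A)"]) (use li in auto)
  then obtain S where S: "maximal S (\<lambda>T. T \<subseteq> set (cols A) \<and> lin_indpt T)" by blast
  have "card S = 1" using rank_card_indpt[OF A S] rk by simp
  then obtain v where v: "S = {v}" by (auto simp: card_1_singleton_iff)
  have sub: "{v} \<subseteq> set (cols A)" "lin_indpt {v}" using S unfolding v maximal_def by auto
  then have vc: "v \<in> carrier_vec n" using cc by auto
  have "\<exists>a. w = a \<cdot>\<^sub>v v" if w: "w \<in> set (cols A)" for w
  proof -
    have wc: "w \<in> carrier_vec n" using w cc by auto
    have "w \<in> span {v}"
    proof (rule ccontr)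
      assume nw: "w \<notin> span {v}"
      then have wv: "w \<notin> {v}" using vc span_mem[of "{v}" v] by auto
      then have "lin_indpt (insert w {v})"
        using lin_dep_iff_in_span[of "{v}" w] sub(2) vc wc nw by auto
      then have "insert w {v} = {v}" using S w sub unfolding v maximal_def by blast
      then show False using wv by auto
    qed
    then obtain a where "w = lincomb a {v}" using vc by (auto simp: finite_span)
    then have "w = a v \<cdot>\<^sub>v v" using vc by (simp add: lincomb_def)
    then show ?thesis ..
  qed
  then obtain a where a: "\<And>w. w \<in> set (cols A) \<Longrightarrow> w = a w \<cdot>\<^sub>v v" by metis
  have "A $$ (i, j) = v $ i * a (col A j)" if "i < n" "j < nc" for i j
  proof -
    have "col A j \<in> set (cols A)" using A that by (metis carrier_matD(2) cols_length cols_nth nth_mem)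
    from a[OF this] have "col A j $ i = (a (col A j) \<cdot>\<^sub>v v) $ i" by simp
    then show ?thesis using A that vc by simp
  qed
  then have "\<forall>i<n. \<forall>j<nc. A $$ (i, j) = v $ i * a (col A j)" by blast
  then show ?thesis by (rule that)
qed

lemma (in vec_space) rank_0_imp_zero:
  assumes A: "A \<in> carrier_mat n nc" and rk: "rank A = 0"
  shows "A = 0\<^sub>m n nc"
proof (rule ccontr)
  assume "A \<noteq> 0\<^sub>m n nc"
  have "\<exists>i<n. \<exists>j<nc. A $$ (i, j) \<noteq> 0"
  proof (rule ccontr)
    assume "\<not> ?thesis"
    then have "A = 0\<^sub>m n nc" using A by (intro eq_matI) auto
    then show False using \<open>A \<noteq> 0\<^sub>m n nc\<close> by simp
  qed
  then obtain i j where ij: "i < n" "j < nc" "A $$ (i, j) \<noteq> 0" by blast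
  define w where "w = col A j"
  have w: "w \<in> set (cols A)" using A ij unfolding w_def by (metis carrier_matD(2) cols_length cols_nth nth_mem)
  have wc: "w \<in> carrier_vec n" using A by (auto simp: w_def)
  have "w $ i \<noteq> 0" using A ij by (simp add: w_def)
  then have w0: "w \<noteq> 0\<^sub>v n" using ij by auto
  have "lin_indpt {}" by (rule finite_lin_indpt2) auto
  then have "lin_indpt {w}" using lin_dep_iff_in_span[of "{}" w] wc w0 by (simp add: span_empty)
  then have "card {w} \<le> rank A" using rank_ge_card_indpt[OF A, of "{w}"] w by simp
  then show False using rk by simp
qed

section \<open>Translation between matrices and functions of two indices\<close>

text \<open>Extension by zero embeds matrices of every size into one vector space.\<close>

definition entries :: "nat \<Rightarrow> real mat \<Rightarrow> nat \<Rightarrow> nat \<Rightarrow> real" where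
  "entries n A = (\<lambda>i j. if i < n \<and> j < n then A $$ (i, j) else 0)"

definition of_entries :: "nat \<Rightarrow> (nat \<Rightarrow> nat \<Rightarrow> real) \<Rightarrow> real mat" where
  "of_entries n M = mat n n (\<lambda>(i, j). M i j)"

lemma of_entries_carrier [simp]: "of_entries n M \<in> carrier_mat n n"
  by (simp add: of_entries_def)

lemma of_entries_index [simp]: "i < n \<Longrightarrow> j < n \<Longrightarrow> of_entries n M $$ (i, j) = M i j"
  by (simp add: of_entries_def)

lemma of_entries_entries: "A \<in> carrier_mat n n \<Longrightarrow> of_entries n (entries n A) = A"
  by (rule eq_matI) (auto simp: of_entries_def entries_def)

lemma entries_zero: "entries n (0\<^sub>m n n) = 0"
  by (simp add: entries_def fun_eq_iff)

lemma of_entries_zero: "of_entries n 0 = 0\<^sub>m n n"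
  by (rule eq_matI) (auto simp: of_entries_def)

lemma entries_diff: "A \<in> carrier_mat n n \<Longrightarrow> B \<in> carrier_mat n n \<Longrightarrow> entries n (A - B) = entries n A - entries n B"
  by (auto simp: entries_def fun_eq_iff)

lemma of_entries_diff: "of_entries n (M - M') = of_entries n M - of_entries n M'"
  by (rule eq_matI) (auto simp: of_entries_def)

lemma entries_inj: "A \<in> carrier_mat n n \<Longrightarrow> B \<in> carrier_mat n n \<Longrightarrow> entries n A = entries n B \<Longrightarrow> A = B"
  by (metis of_entries_entries)

lemma rank_one_sq:
  assumes "of_entries n (t *\<^sub>R sq x) \<noteq> 0\<^sub>m n n"
  shows "mat_rank n (of_entries n (t *\<^sub>R sq x)) = 1"
proof -
  interpret vec_space "TYPE(real)" n .
  have "rank (of_entries n (t *\<^sub>R sq x)) \<le> 1"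
    by (rule rank_le_1_product_entries[of _ n "\<lambda>i. t * x i" x]) (auto simp: of_entries_def sq_def)
  moreover have "rank (of_entries n (t *\<^sub>R sq x)) \<noteq> 0" using rank_0_imp_zero[OF of_entries_carrier] assms by blast
  ultimately show ?thesis by linarith
qed

text \<open>In a factorization \<open>f i * g j\<close> of a symmetric matrix, comparison with an
  index \<open>k\<close> where \<open>f k\<close> is nonzero makes \<open>g\<close> proportional to
  \<open>f\<close>.\<close>

lemma rank_le1_entries:
  assumes A: "A \<in> sym_mats n" and rk: "mat_rank n A = 1"
  shows "rank_le1 (entries n A)"
proof -
  interpret vec_space "TYPE(real)" n .
  have Ac: "A \<in> carrier_mat n n" "transpose_mat A = A" using A by (auto simp: sym_mats_def)
  obtain f g where "\<forall>i<n. \<forall>j<n. A $$ (i, j) = f i * g j"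
    by (rule rank_1_product_entries[OF Ac(1) rk])
  then have fg: "A $$ (i, j) = f i * g j" if "i < n" "j < n" for i j using that by blast
  have symA: "A $$ (i, j) = A $$ (j, i)" if "i < n" "j < n" for i j
    using Ac that by (metis carrier_matD index_transpose_mat(1))
  show ?thesis
  proof (cases "\<exists>k<n. f k \<noteq> 0")
    case True
    then obtain k where k: "k < n" "f k \<noteq> 0" by blast
    define c x where "c = g k / f k" and "x i = (if i < n then f i else 0)" for i
    have "g j = c * f j" if "j < n" for j
      using symA[OF k(1) that] fg[OF k(1) that] fg[OF that k(1)] k(2) by (simp add: c_def field_simps)
    then have "entries n A = c *\<^sub>R sq x" by (auto simp: entries_def sq_def fun_eq_iff fg x_def)
    then show ?thesis by (auto simp: rank_le1_def)
  next
    case False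
    then have "entries n A = 0 *\<^sub>R sq (\<lambda>_. 0)" by (auto simp: entries_def fun_eq_iff fg)
    then show ?thesis unfolding rank_le1_def by blast
  qed
qed

lemma sum_fun_apply: "(\<Sum>i\<in>I. f i) x = (\<Sum>i\<in>I. f i x)"
  by (induction I rule: infinite_finite_induct) auto

text \<open>The copy of real n-space among functions on the naturals; it serves as
  \<open>U\<close>.\<close>

definition supp_vecs :: "nat \<Rightarrow> (nat \<Rightarrow> real) set" where
  "supp_vecs n = {x. \<forall>i\<ge>n. x i = 0}"

lemma subspace_supp_vecs: "subspace (supp_vecs n)"
  by (auto simp: subspace_def supp_vecs_def)

definition unit :: "nat \<Rightarrow> nat \<Rightarrow> real" where
  "unit k = (\<lambda>i. if i = k then 1 else 0)"

lemma unit_supp: "k < n \<Longrightarrow> unit k \<in> supp_vecs n"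
  by (auto simp: unit_def supp_vecs_def)

lemma supp_vecs_sum:
  assumes "x \<in> supp_vecs n"
  shows "x = (\<Sum>k<n. x k *\<^sub>R unit k)"
proof
  fix i
  have "(\<Sum>k<n. x k *\<^sub>R unit k) i = (\<Sum>k<n. if k = i then x k else 0)"
    unfolding sum_fun_apply by (intro sum.cong) (auto simp: unit_def)
  then show "x i = (\<Sum>k<n. x k *\<^sub>R unit k) i" using assms by (auto simp: supp_vecs_def)
qed

lemma span_sq_sym_supp:
  assumes "M \<in> span (sq ` supp_vecs n)"
  shows "M i j = M j i" and "\<not> (i < n \<and> j < n) \<Longrightarrow> M i j = 0"
proof -
  have "(\<forall>i j. M i j = M j i) \<and> (\<forall>i j. \<not> (i < n \<and> j < n) \<longrightarrow> M i j = 0)"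
    using assms by (induction rule: span_induct_alt) (auto simp: sq_def supp_vecs_def)
  then show "M i j = M j i" and "\<not> (i < n \<and> j < n) \<Longrightarrow> M i j = 0" by blast+
qed

lemma of_entries_sym: "M \<in> span (sq ` supp_vecs n) \<Longrightarrow> of_entries n M \<in> sym_mats n"
  using span_sq_sym_supp(1)[of M n] by (auto simp: sym_mats_def of_entries_def intro!: eq_matI)

lemma entries_of_entries: "M \<in> span (sq ` supp_vecs n) \<Longrightarrow> entries n (of_entries n M) = M"
  using span_sq_sym_supp(2)[of M n] by (auto simp: entries_def fun_eq_iff)

text \<open>Polarization puts \<open>sprod\<close> of unit vectors into the span. The factor one
  half compensates for meeting each pair \<open>k, l\<close> in both orders.\<close>

lemma entries_in_span:
  assumes "A \<in> sym_mats n"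
  shows "entries n A \<in> span (sq ` supp_vecs n)"
proof -
  have symA: "A $$ (i, j) = A $$ (j, i)" if "i < n" "j < n" for i j
    using assms that unfolding sym_mats_def by (metis (mono_tags, lifting) carrier_matD index_transpose_mat(1) mem_Collect_eq)
  have sprod: "sprod (unit k) (unit l) \<in> span (sq ` supp_vecs n)" if "k < n" "l < n" for k l
  proof -
    have "unit k + unit l \<in> supp_vecs n"
      using subspace_add[OF subspace_supp_vecs unit_supp[OF that(1)] unit_supp[OF that(2)]] .
    then have "sq (unit k + unit l) - sq (unit k) - sq (unit l) \<in> span (sq ` supp_vecs n)"
      using unit_supp that by (intro span_diff span_base) auto
    then show ?thesis by (simp add: sq_add)
  qed
  have "entries n A i j = (\<Sum>k<n. \<Sum>l<n. (A $$ (k, l) / 2) *\<^sub>R sprod (unit k) (unit l)) i j" for i j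
  proof -
    have "(\<Sum>k<n. \<Sum>l<n. (A $$ (k, l) / 2) *\<^sub>R sprod (unit k) (unit l)) i j
      = (\<Sum>k<n. \<Sum>l<n. (A $$ (k, l) / 2) * (unit k i * unit l j)) + (\<Sum>k<n. \<Sum>l<n. (A $$ (k, l) / 2) * (unit l i * unit k j))"
      by (simp add: sum_fun_apply sprod_def sum.distrib distrib_left)
    also have "(\<Sum>k<n. \<Sum>l<n. (A $$ (k, l) / 2) * (unit k i * unit l j)) = entries n A i j / 2"
    proof -
      have "(\<Sum>l<n. (A $$ (k, l) / 2) * (unit k i * unit l j)) = (if k = i then entries n A i j / 2 else 0)" if "k < n" for k
        using that by (auto simp: unit_def entries_def if_distrib[of "\<lambda>x. _ * x"] cong: if_cong)
      then show ?thesis by (simp add: entries_def)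
    qed
    also have "(\<Sum>k<n. \<Sum>l<n. (A $$ (k, l) / 2) * (unit l i * unit k j)) = entries n A j i / 2"
    proof -
      have "(\<Sum>l<n. (A $$ (k, l) / 2) * (unit l i * unit k j)) = (if k = j then entries n A j i / 2 else 0)" if "k < n" for k
        using that by (auto simp: unit_def entries_def if_distrib[of "\<lambda>x. _ * x"] cong: if_cong)
      then show ?thesis by (simp add: entries_def)
    qed
    also have "entries n A j i = entries n A i j" using symA by (simp add: entries_def)
    finally have "(\<Sum>k<n. \<Sum>l<n. (A $$ (k, l) / 2) *\<^sub>R sprod (unit k) (unit l)) i j = entries n A i j / 2 + entries n A i j / 2" .
    then show ?thesis by (simp only: field_sum_of_halves)
  qed
  then have "entries n A = (\<Sum>k<n. \<Sum>l<n. (A $$ (k, l) / 2) *\<^sub>R sprod (unit k) (unit l))" by (intro ext)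
  then show ?thesis using sprod by (auto intro!: span_sum span_scale)
qed

text \<open>The columns \<open>c k\<close> are independent, so Steinitz exchange with the unit
  vectors completes them to \<open>m\<close> columns spanning the space.\<close>

lemma extend_to_invertible:
  fixes c :: "nat \<Rightarrow> real vec"
  assumes c: "\<And>k. k < n \<Longrightarrow> c k \<in> carrier_vec m"
    and indep: "\<And>v. v \<in> carrier_vec n \<Longrightarrow> mat m n (\<lambda>(i, k). c k $ i) *\<^sub>v v = 0\<^sub>v m \<Longrightarrow> v = 0\<^sub>v n"
  shows "n \<le> m \<and> (\<exists>R \<in> GL m. \<forall>k<n. \<forall>i<m. R $$ (i, k) = c k $ i)"
proof -
  interpret vec_space "TYPE(real)" m .
  define T where "T = mat m n (\<lambda>(i, k). c k $ i)"
  have T: "T \<in> carrier_mat m n" by (simp add: T_def)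
  have col: "col T k = c k" if "k < n" for k
    using c[OF that] that by (intro eq_vecI) (auto simp: T_def)
  have cols: "cols T = map c [0..<n]" using col T by (simp add: cols_def)
  have dist: "distinct (cols T)"
  proof (rule ccontr)
    assume "\<not> distinct (cols T)"
    then have "\<not> inj_on c {0..<n}" by (simp add: cols distinct_map)
    then obtain k l where kl: "k < n" "l < n" "k \<noteq> l" "c k = c l" by (auto simp: inj_on_def)
    have unit: "T *\<^sub>v unit_vec n k = col T k" if "k < n" for k
      using T that by (intro eq_vecI) auto
    have "T *\<^sub>v (unit_vec n k - unit_vec n l) = T *\<^sub>v unit_vec n k - T *\<^sub>v unit_vec n l"
      by (rule mult_minus_distrib_mat_vec[OF T]) auto
    also have "\<dots> = c k - c l"
      using unit[OF kl(1)] unit[OF kl(2)] col kl by simp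
    also have "\<dots> = 0\<^sub>v m" using c[OF kl(2)] kl(4) by auto
    finally have "unit_vec n k - unit_vec n l = (0\<^sub>v n :: real vec)"
      unfolding T_def by (rule indep[rotated]) (intro minus_carrier_vec unit_vec_carrier)
    then have "(unit_vec n k - unit_vec n l) $ k = (0\<^sub>v n :: real vec) $ k" by (rule arg_cong)
    then show False using kl by simp
  qed
  define L where "L = set (cols T)"
  have cardL: "card L = n" unfolding L_def using distinct_card[OF dist] T by simp
  have L: "L \<subseteq> carrier_vec m" "finite L" unfolding L_def using cols_dim[of T] T by auto
  have li: "lin_indpt L"
  proof
    assume "lin_dep L"
    then obtain v where "v \<in> carrier_vec n" "v \<noteq> 0\<^sub>v n" "T *\<^sub>v v = 0\<^sub>v m"
      using lin_depE[OF T _ dist] unfolding L_def by blast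
    then show False using indep unfolding T_def by blast
  qed
  have cU: "card (set (unit_vecs m :: real vec list)) = m"
    using distinct_card[OF unit_vecs_distinct] by simp
  \<comment> \<open>The cardinality bound is over the integers; as a cardinality is nonnegative, it
    also yields \<open>n \<le> m\<close>.\<close>
  obtain C where C: "finite C" "C \<subseteq> carrier_vec m" "int (card C) \<le> int m - int n"
    "span (L \<union> C) = carrier_vec m"
    using replacement[OF L(2) finite_set _ li, of "unit_vecs m"] L(1) unit_vecs_carrier[of m] cU cardL
    by (simp add: span_unit_vecs_is_carrier) blast
  have nm: "n \<le> m" and cC: "card C \<le> m - n" using C(3) by linarith+
  obtain cs where cs: "set cs = C" "distinct cs" using finite_distinct_list[OF C(1)] by blast
  have lcs: "length cs \<le> m - n" using distinct_card[OF cs(2)] cs(1) cC by simp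
  \<comment> \<open>The zero vectors bring the list to length \<open>m\<close> should
    \<open>C\<close> be smaller than \<open>m - n\<close>.\<close>
  define ws where "ws = cols T @ cs @ replicate (m - n - length cs) (0\<^sub>v m)"
  have ws: "set ws \<subseteq> carrier_vec m" "length ws = m" "L \<union> C \<subseteq> set ws"
    using L C(2) cs nm lcs T by (auto simp: ws_def L_def)
  define R where "R = mat_of_cols m ws"
  have R: "R \<in> carrier_mat m m" using mat_of_cols_carrier(1)[of m ws] ws(2) by (simp only: R_def)
  have colsR: "cols R = ws" unfolding R_def by (rule cols_mat_of_cols[OF ws(1)])
  have sp: "span (set (cols R)) = carrier_vec m"
  proof
    show "span (set (cols R)) \<subseteq> carrier_vec m" using span_closed[of "set ws"] ws(1) colsR by auto
    show "carrier_vec m \<subseteq> span (set (cols R))" using span_is_monotone[OF ws(3)] C(4) colsR by simp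
  qed
  have vsV: "vs (carrier_vec m) = V" by (simp add: module_vec_def)
  have "rank R = m" unfolding rank_def sp vsV by (rule dim_is_n)
  then have "det R \<noteq> 0" using det_rank_iff[OF R] by simp
  from det_non_zero_imp_unit[OF R this, of "()"] obtain B where B: "B \<in> carrier_mat m m" "B * R = 1\<^sub>m m" "R * B = 1\<^sub>m m"
    unfolding Units_def ring_mat_def by auto
  then have "invertible_mat R" using R unfolding invertible_mat_def inverts_mat_def by auto
  then have "R \<in> GL m" using R by (simp add: GL_def)
  moreover have "R $$ (i, k) = c k $ i" if "k < n" "i < m" for i k
  proof -
    have "R $$ (i, k) = ws ! k $ i" unfolding R_def using that nm ws(2) by (simp add: mat_of_cols_index)
    also have "ws ! k = c k" using that by (simp add: ws_def nth_append cols)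
    finally show ?thesis .
  qed
  ultimately show ?thesis using nm by blast
qed

theorem theorem1p4:
  fixes m n :: nat and \<Phi> :: "real mat \<Rightarrow> real mat"
  assumes "m \<ge> 1" and "n \<ge> 2"
    and "\<Phi> ` sym_mats n \<subseteq> sym_mats m"
    and "preserves_adjacency n m \<Phi>"
    and "\<Phi> (0\<^sub>m n n) = 0\<^sub>m m m"
  shows "(\<exists>B \<in> sym_mats m. \<exists>f :: real mat \<Rightarrow> real.
            mat_rank m B = 1 \<and> (\<forall>A \<in> sym_mats n. \<Phi> A = f A \<cdot>\<^sub>m B))
       \<or> (m \<ge> n \<and> (\<exists>c \<in> {-1, 1 :: real}. \<exists>R \<in> GL m.
            \<forall>A \<in> sym_mats n. \<Phi> A = c \<cdot>\<^sub>m (R * pad_zero n m A * transpose_mat R)))"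
proof -
  define F where "F M = entries m (\<Phi> (of_entries n M))" for M
  have \<Phi>sym: "\<Phi> A \<in> sym_mats m" if "A \<in> sym_mats n" for A using assms(3) that by blast
  have carr: "A \<in> carrier_mat k k" if "A \<in> sym_mats k" for A k using that by (simp add: sym_mats_def)
  interpret adj_map "supp_vecs n" F
  proof
    show "subspace (supp_vecs n)" by (rule subspace_supp_vecs)
    fix A :: "nat \<Rightarrow> nat \<Rightarrow> real" and x :: "nat \<Rightarrow> real" and t :: real
    assume A: "A \<in> span (sq ` supp_vecs n)" and x: "x \<in> supp_vecs n" "x \<noteq> 0" and t: "t \<noteq> 0"
    define B where "B = A + t *\<^sub>R sq x"
    have tx: "t *\<^sub>R sq x \<in> span (sq ` supp_vecs n)" using x by (intro span_scale span_base) auto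
    then have B: "B \<in> span (sq ` supp_vecs n)" unfolding B_def using A by (rule span_add[rotated])
    have "of_entries n B - of_entries n A = of_entries n (t *\<^sub>R sq x)" unfolding of_entries_diff[symmetric] B_def by simp
    moreover have "of_entries n (t *\<^sub>R sq x) \<noteq> 0\<^sub>m n n"
    proof
      assume "of_entries n (t *\<^sub>R sq x) = 0\<^sub>m n n"
      then have "t *\<^sub>R sq x = 0" using entries_of_entries[OF tx] entries_zero by metis
      then show False using t x by (simp add: sq_eq_0)
    qed
    ultimately have "mat_rank n (of_entries n B - of_entries n A) = 1" using rank_one_sq by simp
    then have "adjacent n (of_entries n B) (of_entries n A)" using of_entries_sym[OF A] of_entries_sym[OF B] by (simp add: adjacent_def)
    then have "adjacent m (\<Phi> (of_entries n B)) (\<Phi> (of_entries n A))"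
      using assms(4) of_entries_sym[OF A] of_entries_sym[OF B] by (simp add: preserves_adjacency_def)
    then have s: "\<Phi> (of_entries n B) \<in> sym_mats m" "\<Phi> (of_entries n A) \<in> sym_mats m"
      and rk: "mat_rank m (\<Phi> (of_entries n B) - \<Phi> (of_entries n A)) = 1" by (auto simp: adjacent_def)
    have d: "\<Phi> (of_entries n B) - \<Phi> (of_entries n A) \<in> sym_mats m"
      using s by (auto simp: sym_mats_def transpose_minus)
    have FB: "F B - F A = entries m (\<Phi> (of_entries n B) - \<Phi> (of_entries n A))"
      unfolding F_def using s carr by (simp add: entries_diff)
    have "rank_le1 (F B - F A)" unfolding FB by (rule rank_le1_entries[OF d rk])
    moreover have "F B \<noteq> F A"
    proof
      assume "F B = F A"
      then have "\<Phi> (of_entries n B) = \<Phi> (of_entries n A)" unfolding F_def using entries_inj s carr by blast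
      then have "\<Phi> (of_entries n B) - \<Phi> (of_entries n A) = 0\<^sub>m m m" using s carr by simp
      then show False using rk vec_space.rank_0I[where 'a = real] by simp
    qed
    ultimately show "F (A + t *\<^sub>R sq x) \<noteq> F A \<and> rank_le1 (F (A + t *\<^sub>R sq x) - F A)" unfolding B_def by simp
  qed
  have F0: "F 0 = 0" unfolding F_def of_entries_zero assms(5) entries_zero ..
  have F_entries: "F (entries n A) = entries m (\<Phi> A)" if "A \<in> sym_mats n" for A
    unfolding F_def using of_entries_entries[OF carr[OF that]] by simp
  have Fsupp: "F M i j = 0" if "\<not> (i < m \<and> j < m)" for M i j using that by (auto simp: F_def entries_def)
  define x0 x1 where "x0 = unit 0" and "x1 = unit 1"
  have x01: "x0 \<in> supp_vecs n" "x1 \<in> supp_vecs n" "nonpar x0 x1"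
    using assms(2) by (auto simp: x0_def x1_def unit_def supp_vecs_def nonpar_def intro!: exI[of _ 0] exI[of _ 1])
  show ?thesis
  proof (cases "\<exists>A p q. separated A p q")
    case False
    obtain f y where fy: "F (0 + sq x0) = F 0 + f *\<^sub>R sq y" "f \<noteq> 0" "y \<noteq> 0"
      by (rule direction[OF span_zero x01(1) nonpar_nz(1)[OF x01(3)]])
    then have y: "F (sq x0) = F 0 + f *\<^sub>R sq y" by (simp only: add_0_left)
    have on: "\<exists>t. F A = t *\<^sub>R sq y" if "A \<in> S" for A
      using degenerate[OF _ x01(1) nonpar_nz(1)[OF x01(3)] y that] False unfolding F0 add_0_left separated_def by blast
    \<comment> \<open>The diagonal entries \<open>f * (y i * y i)\<close> vanish outside the block
      of size \<open>m\<close>.\<close>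
    have ys: "y \<in> supp_vecs m"
    proof -
      have "f * (y i * y i) = 0" if "i \<ge> m" for i
        using fun_cong[OF fun_cong[OF y], of i i] Fsupp[of i i "sq x0"] that by (simp add: F0 sq_def)
      then show ?thesis using fy(2) by (simp add: supp_vecs_def)
    qed
    define B where "B = of_entries m (sq y)"
    have fnB: "entries m B = sq y" unfolding B_def using ys by (intro entries_of_entries span_base) auto
    have Bs: "B \<in> sym_mats m" unfolding B_def using ys by (intro of_entries_sym span_base) auto
    have "of_entries m (1 *\<^sub>R sq y) \<noteq> 0\<^sub>m m m"
    proof
      assume "of_entries m (1 *\<^sub>R sq y) = 0\<^sub>m m m"
      then have "B = 0\<^sub>m m m" by (simp add: B_def)
      then have "sq y = 0" using fnB entries_zero by metis
      then show False using fy(3) by (simp add: sq_eq_0)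
    qed
    from rank_one_sq[OF this] have rkB: "mat_rank m B = 1" by (simp add: B_def)
    have "\<exists>t. \<Phi> A = t \<cdot>\<^sub>m B" if A: "A \<in> sym_mats n" for A
    proof -
      obtain t where t: "F (entries n A) = t *\<^sub>R sq y" using on[OF entries_in_span[OF A]] by blast
      have "entries m (\<Phi> A) = entries m (t \<cdot>\<^sub>m B)"
        using t carr[OF Bs] unfolding F_entries[OF A] fnB[symmetric] by (auto simp: entries_def fun_eq_iff)
      then have "\<Phi> A = t \<cdot>\<^sub>m B" using entries_inj carr[OF \<Phi>sym[OF A]] carr[OF Bs] by (metis smult_carrier_mat)
      then show ?thesis ..
    qed
    then obtain f where "\<forall>A \<in> sym_mats n. \<Phi> A = f A \<cdot>\<^sub>m B" by metis
    then show ?thesis using Bs rkB by blast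
  next
    case True
    then obtain A0 p q where N: "separated A0 p q" by blast
    obtain c T where c: "c \<in> {- 1, 1 :: real}"
      and T: "\<forall>p\<in>supp_vecs n. \<forall>q\<in>supp_vecs n. T (p + q) = T p + T q"
      "\<forall>p\<in>supp_vecs n. \<forall>a. T (a *\<^sub>R p) = a *\<^sub>R T p"
      "\<forall>x\<in>supp_vecs n. x \<noteq> 0 \<longrightarrow> T x \<noteq> 0" "\<forall>x\<in>supp_vecs n. F (sq x) = c *\<^sub>R sq (T x)"
      by (rule nondegenerate_square_root[OF N F0])
    note lin = nondegenerate_linear[OF N F0]
    have c0: "c \<noteq> 0" using c by auto
    have T0: "T 0 = 0"
    proof -
      have "T (0 *\<^sub>R 0) = 0 *\<^sub>R T 0" using T(2) subspace_0[OF subspace_supp_vecs] by blast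
      then show ?thesis by (simp only: scaleR_zero_left)
    qed
    have Tsum: "T (\<Sum>k\<in>K. v k *\<^sub>R unit k) = (\<Sum>k\<in>K. v k *\<^sub>R T (unit k)) \<and> (\<Sum>k\<in>K. v k *\<^sub>R unit k) \<in> supp_vecs n"
      if "K \<subseteq> {..<n}" for K v
    proof -
      have "finite K" using that finite_subset by blast
      then show ?thesis using that
      proof (induction K rule: finite_induct)
        case empty
        show ?case using T0 subspace_0[OF subspace_supp_vecs] by (simp only: sum.empty simp_thms)
      next
        case (insert k K)
        then have u: "unit k \<in> supp_vecs n" by (intro unit_supp) auto
        then have vu: "v k *\<^sub>R unit k \<in> supp_vecs n" by (rule subspace_scale[OF subspace_supp_vecs])
        have IH: "T (\<Sum>k\<in>K. v k *\<^sub>R unit k) = (\<Sum>k\<in>K. v k *\<^sub>R T (unit k))" "(\<Sum>k\<in>K. v k *\<^sub>R unit k) \<in> supp_vecs n"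
          using insert by blast+
        show ?case
          unfolding sum.insert[OF insert(1,2)] T(1)[rule_format, OF vu IH(2)] T(2)[rule_format, OF u] IH(1)
          using subspace_add[OF subspace_supp_vecs vu IH(2)] by blast
      qed
    qed
    have Tx: "T x = (\<Sum>k<n. x k *\<^sub>R T (unit k))" if "x \<in> supp_vecs n" for x
      using Tsum[of "{..<n}" x] supp_vecs_sum[OF that] by simp
    have Tm: "T x \<in> supp_vecs m" if "x \<in> supp_vecs n" for x
    proof -
      have "c * (T x i * T x i) = 0" if "i \<ge> m" for i
        using fun_cong[OF fun_cong[OF T(4)[rule_format, OF \<open>x \<in> supp_vecs n\<close>]], of i i] Fsupp[of i i "sq x"] that
        by (simp add: sq_def)
      then show ?thesis using c0 by (simp add: supp_vecs_def)
    qed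
    define C where "C k = vec m (T (unit k))" for k
    have "n \<le> m \<and> (\<exists>R \<in> GL m. \<forall>k<n. \<forall>i<m. R $$ (i, k) = C k $ i)"
    proof (rule extend_to_invertible)
      fix v :: "real vec" assume v: "v \<in> carrier_vec n" and z: "mat m n (\<lambda>(i, k). C k $ i) *\<^sub>v v = 0\<^sub>v m"
      define x where "x i = (if i < n then v $ i else 0)" for i
      have x: "x \<in> supp_vecs n" by (simp add: x_def supp_vecs_def)
      have "T x i = 0" for i
      proof (cases "i < m")
        case True
        have "T x i = (\<Sum>k<n. v $ k * T (unit k) i)" unfolding Tx[OF x] sum_fun_apply by (simp add: x_def)
        also have "\<dots> = (mat m n (\<lambda>(i, k). C k $ i) *\<^sub>v v) $ i"
          using True v by (simp add: scalar_prod_def C_def lessThan_atLeast0 mult.commute)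
        finally show ?thesis unfolding z using True by simp
      next
        case False
        then show ?thesis using Tm[OF x] by (simp add: supp_vecs_def)
      qed
      then have "x = 0" using T(3) x by (metis ext zero_fun_def)
      then have "x k = 0" for k by simp
      then have "v $ k = 0" if "k < n" for k using that unfolding x_def by metis
      then show "v = 0\<^sub>v n" using v by (intro eq_vecI) auto
    qed (simp add: C_def)
    then obtain R where nm: "n \<le> m" and R: "R \<in> GL m" and RC: "\<And>k i. k < n \<Longrightarrow> i < m \<Longrightarrow> R $$ (i, k) = T (unit k) i"
      by (auto simp: C_def)
    have Rc: "R \<in> carrier_mat m m" using R by (simp add: GL_def)
    \<comment> \<open>Both sides are linear in \<open>M\<close> and agree on every
      \<open>sq x\<close>, where \<open>T x\<close> is expanded in the vectors
      \<open>T (unit k)\<close>.\<close>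
    have form: "F M i j = c * (\<Sum>k<n. \<Sum>l<n. T (unit k) i * M k l * T (unit l) j)" if "M \<in> S" for M i j
    proof -
      have "M \<in> S \<and> F M i j = c * (\<Sum>k<n. \<Sum>l<n. T (unit k) i * M k l * T (unit l) j)" using that
      proof (induction rule: span_induct_alt)
        case base
        have "F 0 i j = 0" unfolding F0 by simp
        moreover have "c * (\<Sum>k<n. \<Sum>l<n. T (unit k) i * 0 k l * T (unit l) j) = 0" by simp
        ultimately show ?case using span_zero by metis
      next
        case (step a Z M)
        then obtain x where x: "Z = sq x" "x \<in> supp_vecs n" by auto
        have ZS: "Z \<in> S" and aZ: "a *\<^sub>R Z \<in> S" using S_sq[OF x(2), of 1] S_sq[OF x(2), of a] by (simp_all add: x(1))
        have M: "M \<in> S" using step by blast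
        have "F (a *\<^sub>R Z + M) = a *\<^sub>R F Z + F M" by (simp only: lin(1)[OF aZ M] lin(2)[OF span_zero ZS])
        then have "F (a *\<^sub>R Z + M) i j = a * (c * (T x i * T x j)) + F M i j"
          using T(4) x by (simp add: sq_def)
        also have "T x i * T x j = (\<Sum>k<n. \<Sum>l<n. T (unit k) i * Z k l * T (unit l) j)"
          unfolding Tx[OF x(2)] sum_fun_apply
          by (simp add: sum_product x(1) sq_def mult.assoc mult.left_commute)
        also have "F M i j = c * (\<Sum>k<n. \<Sum>l<n. T (unit k) i * M k l * T (unit l) j)" using step by blast
        also have "a * (c * (\<Sum>k<n. \<Sum>l<n. T (unit k) i * Z k l * T (unit l) j))
            + c * (\<Sum>k<n. \<Sum>l<n. T (unit k) i * M k l * T (unit l) j)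
          = c * (\<Sum>k<n. \<Sum>l<n. T (unit k) i * (a *\<^sub>R Z + M) k l * T (unit l) j)"
          by (simp add: sum_distrib_left sum.distrib algebra_simps)
        finally have "F (a *\<^sub>R Z + M) i j
          = c * (\<Sum>k<n. \<Sum>l<n. T (unit k) i * (a *\<^sub>R Z + M) k l * T (unit l) j)" .
        then show ?case using span_add[OF aZ M] by blast
      qed
      then show ?thesis by blast
    qed
    have "\<Phi> A = c \<cdot>\<^sub>m (R * pad_zero n m A * transpose_mat R)" if A: "A \<in> sym_mats n" for A
    proof (rule eq_matI)
      have Ac: "A \<in> carrier_mat n n" by (rule carr[OF A])
      have P: "pad_zero n m A \<in> carrier_mat m m"
        using Ac nm unfolding pad_zero_def by (metis four_block_carrier_mat le_add_diff_inverse zero_carrier_mat)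
      have Pi: "pad_zero n m A $$ (k, l) = (if k < n \<and> l < n then A $$ (k, l) else 0)" if "k < m" "l < m" for k l
        using that nm Ac by (auto simp: pad_zero_def)
      have \<Phi>c: "\<Phi> A \<in> carrier_mat m m" by (rule carr[OF \<Phi>sym[OF A]])
      show "dim_row (\<Phi> A) = dim_row (c \<cdot>\<^sub>m (R * pad_zero n m A * transpose_mat R))"
        "dim_col (\<Phi> A) = dim_col (c \<cdot>\<^sub>m (R * pad_zero n m A * transpose_mat R))"
        using \<Phi>c Rc P by auto
      fix i j assume "i < dim_row (c \<cdot>\<^sub>m (R * pad_zero n m A * transpose_mat R))"
        "j < dim_col (c \<cdot>\<^sub>m (R * pad_zero n m A * transpose_mat R))"
      then have ij: "i < m" "j < m" using Rc by auto
      have RP: "(R * pad_zero n m A) $$ (i, l) = (if l < n then \<Sum>k<n. T (unit k) i * A $$ (k, l) else 0)" if "l < m" for l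
      proof -
        have "(R * pad_zero n m A) $$ (i, l) = (\<Sum>k<m. R $$ (i, k) * pad_zero n m A $$ (k, l))"
          using Rc P ij that by (simp add: scalar_prod_def lessThan_atLeast0)
        also have "\<dots> = (\<Sum>k<n. R $$ (i, k) * pad_zero n m A $$ (k, l))"
          \<comment> \<open>The zeros of the padding leave only \<open>k < n\<close>, where the
            columns of \<open>R\<close> are the vectors \<open>T (unit k)\<close>.\<close>
          using nm that by (intro sum.mono_neutral_right) (auto simp: Pi)
        also have "\<dots> = (if l < n then \<Sum>k<n. T (unit k) i * A $$ (k, l) else 0)"
          using nm that ij by (auto simp: Pi RC)
        finally show ?thesis .
      qed
      have "(R * pad_zero n m A * transpose_mat R) $$ (i, j) = (\<Sum>l<m. (R * pad_zero n m A) $$ (i, l) * R $$ (j, l))"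
      proof -
        have "(X * transpose_mat R) $$ (i, j) = (\<Sum>l<m. X $$ (i, l) * R $$ (j, l))"
          if "X \<in> carrier_mat m m" for X
          using Rc ij that by (simp add: scalar_prod_def lessThan_atLeast0)
        from this[OF mult_carrier_mat[OF Rc P]] show ?thesis .
      qed
      also have "\<dots> = (\<Sum>l<n. (R * pad_zero n m A) $$ (i, l) * R $$ (j, l))"
        using nm by (intro sum.mono_neutral_right) (auto simp: RP)
      also have "\<dots> = (\<Sum>l<n. \<Sum>k<n. T (unit k) i * A $$ (k, l) * T (unit l) j)"
        using nm ij by (intro sum.cong) (auto simp: RP RC sum_distrib_right)
      also have "\<dots> = (\<Sum>k<n. \<Sum>l<n. T (unit k) i * entries n A k l * T (unit l) j)"
        by (subst sum.swap) (auto simp: entries_def)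
      finally have e: "(R * pad_zero n m A * transpose_mat R) $$ (i, j) =
        (\<Sum>k<n. \<Sum>l<n. T (unit k) i * entries n A k l * T (unit l) j)" .
      have "\<Phi> A $$ (i, j) = F (entries n A) i j" unfolding F_entries[OF A] using ij by (simp add: entries_def)
      also have "\<dots> = c * (R * pad_zero n m A * transpose_mat R) $$ (i, j)"
        unfolding e by (rule form[OF entries_in_span[OF A]])
      also have "\<dots> = (c \<cdot>\<^sub>m (R * pad_zero n m A * transpose_mat R)) $$ (i, j)"
        using ij Rc by simp
      finally show "\<Phi> A $$ (i, j) = (c \<cdot>\<^sub>m (R * pad_zero n m A * transpose_mat R)) $$ (i, j)" .
    qed
    then show ?thesis using nm c R by blast
  qed
qed

end
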